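(* Let $\ell_1$ and $\ell_2$ be nonnegative integers. Then, as $n\to+\infty$, $$\sum_{k=1}^n\frac{A(n,k)}{n!}\,(n-k)^{\ell_1}(\mu_n-\mu_k)^{\ell_2}=B_{\ell_1+\ell_2}+O(n^{-1}),$$ where the implied constant depends only on $\ell_1$ and $\ell_2$.
   Context: For $n\ge 0$ let $A(n):=\frac{(n+2)!}{n+1}\sum_{i=0}^{n+2}\frac{(-1)^i}{i!}$, and for $1\le k\le n$ let $A(n,k):=\binom{n-1}{k-1}A(k-1)$. $\mu_n=\mathbf{E}[X_n]$, where $X_n$ is defined by the following process. For a positive integer $n$, take a uniformly random permutation $\tau$ of $[n]=\{1,\ldots,n\}$. A block of $\tau$ is a maximal sequence of (increasing) consecutive integers $a,a+1,\ldots,a+r$ ($r\ge 0$) that appear, in this order, in adjacent positions of $\tau$. Each block is merged into its first integer and the elements of the new set are relabeled from $1$ to the current number of elements, giving $[k]$ where $k$ is the number of blocks. One then takes a new, independent, uniformly random permutation of $[k]$, merges again, and so on, until only one integer is left. $X_n$ is the number of permutations used until the process ends; by convention $X_1=0$, so $\mu_1=0$. Equivalently, for $n\ge2$, $X_n$ has the law of $1+\widetilde X_{Y_n}$, where $Y_n$ is the number of blocks in a uniformly random permutation of $[n]$ (so that $\mathbf{P}(Y_n=k)=A(n,k)/n!$) and the $\widetilde X_k$ are independent of $Y_n$ and of each other, with $\widetilde X_k$ distributed as $X_k$. $B_\ell$ is the $\ell$-th Bell number, defined by $\sum_{\ell=0}^\infty B_\ell\frac{x^\ell}{\ell!}=e^{e^x-1}$.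 Convention: $0^0=1$. *)

theory Defs
  imports
    "HOL-Probability.Probability"
    "HOL-Library.Landau_Symbols"
    "HOL-Computational_Algebra.Formal_Power_Series"
begin

definition A1 :: "nat \<Rightarrow> real" where
  "A1 n = fact (n + 2) / real (n + 1) * (\<Sum>i=0..n+2. (-1) ^ i / fact i)"

definition A2 :: "nat \<Rightarrow> nat \<Rightarrow> real" where
  "A2 n k = real ((n - 1) choose (k - 1)) * A1 (k - 1)"

text \<open>
  A permutation \<open>\<tau>\<close> of \<open>{1..n}\<close> is read as the word \<open>\<tau> 1, \<dots>, \<tau> n\<close>. A run is
  identified with the set of its values \<open>{a..a + r}\<close>, and \<open>i\<close> is the position where it starts.
\<close>

definition runs :: "nat \<Rightarrow> (nat \<Rightarrow> nat) \<Rightarrow> nat set set" where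
  "runs n \<tau> = {{a..a + r} | a r i. 1 \<le> i \<and> i + r \<le> n \<and> (\<forall>j\<le>r. \<tau> (i + j) = a + j)}"

definition blocks :: "nat \<Rightarrow> (nat \<Rightarrow> nat) \<Rightarrow> nat set set" where
  "blocks n \<tau> = {B \<in> runs n \<tau>. \<forall>C \<in> runs n \<tau>. B \<subseteq> C \<longrightarrow> C = B}"

text \<open>
  A sample point \<open>\<omega>\<close> provides, at every time \<open>t\<close> and for every size \<open>k\<close>, a uniformly random
  permutation \<open>(\<omega> !! t) k\<close> of \<open>{1..k}\<close>, all of them independent. At time \<open>t\<close> the process only
  uses the one whose size is the current number of elements.
\<close>

definition perm_space :: "(nat \<Rightarrow> nat \<Rightarrow> nat) stream measure" where
  "perm_space =
     stream_space (PiM UNIV (\<lambda>k. measure_pmf (pmf_of_set {\<tau>. \<tau> permutes {1..k}})))"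

text \<open>
  After merging and relabelling, the set of elements is \<open>{1..k}\<close> with \<open>k\<close> the number of blocks,
  so the state of the process is just its size. The size 1 is absorbing.
\<close>

primrec size_after :: "nat \<Rightarrow> (nat \<Rightarrow> nat \<Rightarrow> nat) stream \<Rightarrow> nat \<Rightarrow> nat" where
  "size_after n \<omega> 0 = n"
| "size_after n \<omega> (Suc t) =
     (let k = size_after n \<omega> t in card (blocks k ((\<omega> !! t) k)))"

definition X :: "nat \<Rightarrow> (nat \<Rightarrow> nat \<Rightarrow> nat) stream \<Rightarrow> enat" where
  "X n \<omega> = Inf {enat t | t. size_after n \<omega> t = 1}"

text \<open>
  For \<open>n \<ge> 1\<close> the integral is finite: a set of size \<open>k \<le> n\<close> is merged into a single element
  with probability \<open>1 / k! \<ge> 1 / n!\<close>, so \<open>X n\<close> has a geometric tail.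
\<close>

definition \<mu> :: "nat \<Rightarrow> real" where
  "\<mu> n = enn2real (\<integral>\<^sup>+ \<omega>. ennreal_of_enat (X n \<omega>) \<partial>perm_space)"

text \<open>The coefficients of the exponential generating function \<open>e\<^bsup>e\<^sup>x - 1\<^esup>\<close>.\<close>

definition Bell :: "nat \<Rightarrow> real" where
  "Bell l = fact l * fps_nth (fps_exp 1 oo (fps_exp 1 - 1)) l"

end

theory Submission
  imports Defs "HOL-Combinatorics.Multiset_Permutations"
begin

text \<open>
  The number of blocks is \<open>n\<close> minus the number of successions. Inserting \<open>n + 1\<close> into a word
  on \<open>{1..n}\<close> changes the number of successions in a controlled way, which yields the law
  \<open>P (Y\<^sub>n = n - j) = (n - j + 1) / (n j!) \<Sum>\<^bsub>i \<le> n - j + 1\<^esub> (-1)\<^sup>i / i!\<close> and the mean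
  \<open>n - 1 + 1 / n\<close>. Hence \<open>n - Y\<^sub>n\<close> is Poisson(1) up to \<open>O (1 / n)\<close>, and its
  \<open>l\<close>-th moment tends to the Bell number by Dobinski's formula.

  Conditioning on the first permutation, \<open>\<nu> n = \<mu> n - n\<close> satisfies
  \<open>\<Sum>\<^bsub>j\<^esub> P (Y\<^sub>n = n - j) (\<nu> n - \<nu> (n - j)) = 1 / n\<close>. This is a renewal equation for the increments
  of \<open>\<nu>\<close> with a dominant diagonal, so these increments are \<open>O (1 / n)\<close> and \<open>\<mu> n - \<mu> (n - j)\<close>
  may be replaced by \<open>j\<close>.
\<close>

subsection \<open>Successions\<close>

fun succs :: "nat list \<Rightarrow> nat" where
  "succs (x # y # zs) = of_bool (y = Suc x) + succs (y # zs)"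
| "succs _ = 0"

lemma succs_snoc: "succs (xs @ [y]) = succs xs + of_bool (xs \<noteq> [] \<and> y = Suc (last xs))"
  by (induction xs rule: succs.induct) auto

lemma succs_less_length: "xs \<noteq> [] \<Longrightarrow> succs xs < length xs"
  by (induction xs rule: succs.induct) auto

lemma succs_le_length: "succs xs \<le> length xs"
  using succs_less_length[of xs] by (cases xs) auto

text \<open>
  Only the insertion right after \<open>v\<close> creates a succession, and exactly the insertions into the
  middle of an existing succession destroy one.
\<close>

lemma sum_insert_succs:
  fixes g :: "nat \<Rightarrow> real"
  assumes "distinct xs" "\<forall>x\<in>set xs. x \<le> v"
  shows "(\<Sum>i\<le>length xs. g (succs (take i xs @ Suc v # drop i xs))) =
    of_bool (v \<in> set xs) * g (Suc (succs xs)) + real (succs xs) * g (succs xs - 1)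
    + (real (length xs) + 1 - of_bool (v \<in> set xs) - real (succs xs)) * g (succs xs)"
  using assms
proof (induction xs arbitrary: g rule: succs.induct)
  case (1 x y zs)
  define b :: nat where "b = of_bool (y = Suc x)"
  define s where "s = succs (y # zs)"
  \<comment> \<open>The hypothesis is available for arbitrary \<open>g\<close>, so the contribution
    \<open>b\<close> of the first pair is absorbed into the test function.\<close>
  define g' where "g' = (\<lambda>k. g (b + k))"
  have s: "succs (x # y # zs) = b + s" by (simp add: b_def s_def)
  let ?f = "\<lambda>xs i. succs (take i xs @ Suc v # drop i xs)"
  have y: "y \<le> v" "x \<le> v" "x \<noteq> y" using 1 by auto
  have Sv: "y \<noteq> Suc v" "y \<noteq> Suc (Suc v)" using y by auto
  have IH: "(\<Sum>i\<le>length (y#zs). g' (?f (y#zs) i)) =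
    of_bool (v \<in> set (y#zs)) * g' (Suc s) + real s * g' (s - 1)
    + (real (length (y#zs)) + 1 - of_bool (v \<in> set (y#zs)) - real s) * g' s"
    unfolding s_def by (rule "1.IH") (use "1.prems" in auto)
  \<comment> \<open>In front of \<open>y\<close>, \<open>Suc v\<close> behaves differently in
    \<open>y # zs\<close> and between \<open>x\<close> and \<open>y\<close>. This position is
    therefore split off; all later ones agree in both words.\<close>
  have split: "(\<Sum>i\<le>length (y#zs). g' (?f (y#zs) i)) = g' s + (\<Sum>i\<le>length zs. g' (?f (y#zs) (Suc i)))"
    unfolding list.size(4) Nat.add_0_right add_Suc_right by (subst sum.atMost_Suc_shift) (simp add: s_def Sv)
  have "(\<Sum>i\<le>length (x#y#zs). g (?f (x#y#zs) i)) =
     g (b + s) + g (of_bool (x = v) + s) + (\<Sum>i\<le>length zs. g (?f (x#y#zs) (Suc (Suc i))))"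
    using y unfolding list.size(4) Nat.add_0_right add_Suc_right
    by (subst sum.atMost_Suc_shift, subst sum.atMost_Suc_shift) (auto simp: s_def b_def)
  also have "(\<Sum>i\<le>length zs. g (?f (x#y#zs) (Suc (Suc i)))) = (\<Sum>i\<le>length zs. g' (?f (y#zs) (Suc i)))"
    by (simp add: g'_def b_def)
  also have "\<dots> = of_bool (v \<in> set (y#zs)) * g' (Suc s) + real s * g' (s - 1)
    + (real (length (y#zs)) + 1 - of_bool (v \<in> set (y#zs)) - real s) * g' s - g' s"
    using split IH by linarith
  finally have eq: "(\<Sum>i\<le>length (x#y#zs). g (?f (x#y#zs) i)) =
    g (b + s) + g (of_bool (x = v) + s) + (of_bool (v \<in> set (y#zs)) * g (b + Suc s) + real s * g (b + (s - 1))
    + (real (length (y#zs)) + 1 - of_bool (v \<in> set (y#zs)) - real s) * g (b + s) - g (b + s))"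
    unfolding g'_def .
  show ?case
  proof (cases "b = 0")
    case True
    show ?thesis unfolding eq s using True "1.prems" by (auto simp: algebra_simps)
  next
    case False
    then have b: "b = 1" "y = Suc x" by (auto simp: b_def split: if_splits)
    then have "x \<noteq> v" using y by auto
    \<comment> \<open>At \<open>s = 0\<close> the truncated \<open>s - 1\<close> does no harm,
      because of the factor \<open>real s\<close>.\<close>
    moreover have "real s * g (Suc (s - Suc 0)) = real s * g s" by (cases s) auto
    ultimately show ?thesis unfolding eq s using b y "1.prems" by (auto simp: algebra_simps)
  qed
qed auto

text \<open>Deleting \<open>m\<close> and recording its position inverts the insertion, so every
  word on \<open>insert m A\<close> arises exactly once.\<close>

lemma sum_permutations_of_set_insert:
  assumes "finite A" "m \<notin> A"
  shows "(\<Sum>xs\<in>permutations_of_set (insert m A). f xs) =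
    (\<Sum>ys\<in>permutations_of_set A. \<Sum>i\<le>card A. f (take i ys @ m # drop i ys))"
proof -
  have len: "length ys = card A" "set ys = A" "distinct ys" if "ys \<in> permutations_of_set A" for ys
    using that by (auto simp: permutations_of_set_def distinct_card)
  have "(\<Sum>ys\<in>permutations_of_set A. \<Sum>i\<le>card A. f (take i ys @ m # drop i ys)) =
    (\<Sum>(ys,i)\<in>permutations_of_set A \<times> {..card A}. f (take i ys @ m # drop i ys))"
    by (rule sum.cartesian_product)
  also have "\<dots> = (\<Sum>xs\<in>permutations_of_set (insert m A). f xs)"
  proof (rule sum.reindex_bij_witness[where j = "\<lambda>(ys,i). take i ys @ m # drop i ys"
        and i = "\<lambda>xs. (remove1 m xs, length (takeWhile (\<lambda>x. x \<noteq> m) xs))"])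
    fix xs assume "xs \<in> permutations_of_set (insert m A)"
    then have xs: "set xs = insert m A" "distinct xs" by (auto simp: permutations_of_set_def)
    then obtain as bs where ab: "xs = as @ m # bs" using split_list[of m xs] by auto
    have m: "m \<notin> set as" "m \<notin> set bs" using xs ab by auto
    then have t: "takeWhile (\<lambda>x. x \<noteq> m) xs = as" unfolding ab by (subst takeWhile_append2) auto
    have r: "remove1 m xs = as @ bs" unfolding ab using m by (simp add: remove1_append)
    have ins: "set (as @ bs) = A" using xs m assms unfolding ab by auto
    have "distinct (as @ bs)" using xs ab by auto
    then have "length (as @ bs) = card A" using distinct_card ins by metis
    then show "(case (remove1 m xs, length (takeWhile (\<lambda>x. x \<noteq> m) xs)) of (ys,i) \<Rightarrow> take i ys @ m # drop i ys) = xs"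
      "(remove1 m xs, length (takeWhile (\<lambda>x. x \<noteq> m) xs)) \<in> permutations_of_set A \<times> {..card A}"
      using ins \<open>distinct (as @ bs)\<close> unfolding t r by (auto simp: ab permutations_of_set_def)
  next
    fix p assume "p \<in> permutations_of_set A \<times> {..card A}"
    then obtain ys i where p: "p = (ys, i)" and ys: "ys \<in> permutations_of_set A" and i: "i \<le> card A"
      by auto
    note l = len[OF ys]
    have nm: "m \<notin> set (take i ys)" using l assms by (auto dest: in_set_takeD)
    have nd: "m \<notin> set (drop i ys)" using l assms by (auto dest: in_set_dropD)
    have u: "set (take i ys) \<union> set (drop i ys) = A"
      using l by (metis append_take_drop_id set_append)
    show "(remove1 m (case p of (ys,i) \<Rightarrow> take i ys @ m # drop i ys), length (takeWhile (\<lambda>x. x \<noteq> m) (case p of (ys,i) \<Rightarrow> take i ys @ m # drop i ys))) = p"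
      unfolding p using nm i l by (auto simp: remove1_append takeWhile_append)
    show "(case p of (ys,i) \<Rightarrow> take i ys @ m # drop i ys) \<in> permutations_of_set (insert m A)"
      unfolding p using l nm nd u by (auto simp: permutations_of_set_def set_take_disj_set_drop_if_distinct)
    show "f (case p of (ys,i) \<Rightarrow> take i ys @ m # drop i ys) = (case p of (ys,i) \<Rightarrow> f (take i ys @ m # drop i ys))"
      unfolding p by simp
  qed
  finally show ?thesis ..
qed

text \<open>A nonempty word on \<open>{1..n}\<close> contains its upper bound \<open>n\<close>, so
  \<open>v = n\<close> makes both indicators in \<open>sum_insert_succs\<close> equal to 1.
  Indicators for \<open>g\<close> give the law of the number of successions, the identity gives its
  mean.\<close>

lemma sum_succs_Suc:
  fixes g :: "nat \<Rightarrow> real"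
  assumes "n \<ge> 1"
  shows "(\<Sum>xs\<in>permutations_of_set {1..Suc n}. g (succs xs)) =
    (\<Sum>xs\<in>permutations_of_set {1..n}. g (Suc (succs xs)) + real (succs xs) * g (succs xs - 1)
       + (real n - real (succs xs)) * g (succs xs))"
proof -
  have ins: "{1..Suc n} = insert (Suc n) {1..n}" by auto
  show ?thesis
    unfolding ins
  proof (subst sum_permutations_of_set_insert; (intro sum.cong refl)?)
    fix xs assume "xs \<in> permutations_of_set {1..n}"
    then have xs: "set xs = {1..n}" "distinct xs" "length xs = n"
      by (auto simp: permutations_of_set_def dest: distinct_card)
    have "(\<Sum>i\<le>card {1..n}. g (succs (take i xs @ Suc n # drop i xs))) =
       (\<Sum>i\<le>length xs. g (succs (take i xs @ Suc n # drop i xs)))" using xs by simp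
    also note sum_insert_succs
    finally show "(\<Sum>i\<le>card {1..n}. g (succs (take i xs @ Suc n # drop i xs))) =
        g (Suc (succs xs)) + real (succs xs) * g (succs xs - 1) + (real n - real (succs xs)) * g (succs xs)"
      using xs assms by simp
  qed auto
qed

section \<open>Law and mean of the number of successions\<close>

definition altsum :: "nat \<Rightarrow> real" where
  "altsum m = (\<Sum>i\<le>m. (-1) ^ i / fact i)"

text \<open>With \<open>D m = fact m * altsum m\<close>, the number of derangements, multiplication
  by \<open>fact (m + 1)\<close> turns this into the classical
  \<open>D (m + 2) = (m + 1) * (D (m + 1) + D m)\<close>.\<close>

lemma altsum_rec: "real (m + 2) * altsum (m + 2) = real (m + 1) * altsum (m + 1) + altsum m"
proof -
  have 1: "altsum (m + 1) = altsum m - (-1) ^ m / fact (m + 1)"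
    by (simp add: altsum_def)
  have 2: "altsum (m + 2) = altsum (m + 1) + (-1) ^ m / fact (m + 2)"
    by (simp add: altsum_def)
  have 3: "real (m + 2) * ((-1) ^ m / fact (m + 2)) = (-1) ^ m / fact (m + 1)"
  proof -
    have "(fact (m + 2) :: real) = real (m + 2) * fact (m + 1)" by simp
    then show ?thesis by (simp del: fact_Suc of_nat_add)
  qed
  have "real (m + 2) * altsum (m + 2) = real (m + 2) * altsum (m + 1) + (-1) ^ m / fact (m + 1)"
    unfolding 2 distrib_left 3 ..
  then show ?thesis using 1 by (simp add: algebra_simps)
qed

definition count_succs :: "nat \<Rightarrow> nat \<Rightarrow> real" where
  "count_succs n j = (\<Sum>xs\<in>permutations_of_set {1..n}. of_bool (succs xs = j))"

lemma count_succs_Suc: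
  assumes "n \<ge> 1"
  shows "count_succs (Suc n) j = (if j = 0 then 0 else count_succs n (j - 1))
    + real (j + 1) * count_succs n (j + 1) + (real n - real j) * count_succs n j"
proof -
  have *: "of_bool (Suc s = j) + real s * of_bool (s - 1 = j) + (real n - real s) * of_bool (s = j) =
     (if j = 0 then 0 else of_bool (s = j - 1)) + real (j + 1) * of_bool (s = j + 1) + (real n - real j) * of_bool (s = j)" for s
    by (cases s; cases j) auto
  have "count_succs (Suc n) j = (\<Sum>xs\<in>permutations_of_set {1..n}.
     (if j = 0 then 0 else of_bool (succs xs = j - 1)) + real (j + 1) * of_bool (succs xs = j + 1)
     + (real n - real j) * of_bool (succs xs = j))"
    unfolding count_succs_def sum_succs_Suc[OF assms, of "\<lambda>s. of_bool (s = j)"] * ..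
  then show ?thesis
    by (cases "j = 0") (simp_all only: count_succs_def sum.distrib sum_distrib_left if_True if_False sum.neutral_const simp_thms)
qed

lemma count_succs_eq_0:
  assumes "n \<ge> 1" "j \<ge> n" shows "count_succs n j = 0"
  unfolding count_succs_def
proof (intro sum.neutral ballI)
  fix xs assume "xs \<in> permutations_of_set {1..n}"
  then have "length xs = n" by (auto simp: permutations_of_set_def dest: distinct_card)
  with succs_less_length[of xs] assms have "succs xs < n" by (cases xs) auto
  with assms show "of_bool (succs xs = j) = (0::real)" by auto
qed

lemma count_succs_formula:
  assumes "j \<le> n"
  shows "count_succs (Suc n) j = fact n / fact j * (real (n - j) + 2) * altsum (n - j + 2)"
  using assms
proof (induction n arbitrary: j)
  case 0
  have "permutations_of_set {1::nat} = {[1]}" by auto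
  then show ?case using 0 by (simp add: count_succs_def altsum_def numeral_2_eq_2)
next
  case (Suc n)
  have rec: "count_succs (Suc (Suc n)) j = (if j = 0 then 0 else count_succs (Suc n) (j - 1))
    + real (j + 1) * count_succs (Suc n) (j + 1) + (real (Suc n) - real j) * count_succs (Suc n) j"
    by (rule count_succs_Suc) simp
  show ?case
  \<comment> \<open>For \<open>j = Suc n\<close> only the term from \<open>j - 1\<close> survives,
    as words of length \<open>Suc n\<close> have at most \<open>n\<close> successions.\<close>
  proof (cases "j = Suc n")
    case True
    then have "count_succs (Suc (Suc n)) j = count_succs (Suc n) n"
      unfolding rec by (simp add: count_succs_eq_0)
    then show ?thesis using True Suc.IH[of n] by simp
  next
    case False
    define m where "m = n - j"
    have n: "n = m + j" using False Suc.prems by (simp add: m_def)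
    have t1: "(if j = 0 then 0 else count_succs (Suc n) (j - 1)) =
        real j * (fact n / fact j) * (real m + 3) * altsum (m + 3)"
    proof (cases j)
      case (Suc i)
      have "count_succs (Suc n) i = fact n / fact i * (real (n - i) + 2) * altsum (n - i + 2)"
        by (rule Suc.IH) (use n Suc in simp)
      then show ?thesis using Suc n by (simp add: numeral_3_eq_3 add.commute)
    qed auto
    have t2: "real (j + 1) * count_succs (Suc n) (j + 1) = fact n / fact j * (real m + 1) * altsum (m + 1)"
    \<comment> \<open>For \<open>m = 0\<close> the index \<open>j + 1\<close> leaves the range of
      the hypothesis; the formula persists because \<open>altsum 1 = 0\<close>.\<close>
    proof (cases m)
      case 0
      then show ?thesis using n by (simp add: count_succs_eq_0 altsum_def)
    next
      case (Suc i)
      have "count_succs (Suc n) (j + 1) = fact n / fact (j + 1) * (real (n - (j + 1)) + 2) * altsum (n - (j + 1) + 2)"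
        by (rule Suc.IH) (use n Suc in simp)
      then show ?thesis using Suc n by (simp add: divide_simps) (simp add: algebra_simps)
    qed
    have t3: "count_succs (Suc n) j = fact n / fact j * (real m + 2) * altsum (m + 2)"
      unfolding m_def by (rule Suc.IH) (use n in simp)
    \<comment> \<open>This recurrence lets the three terms share the factor
      \<open>(m + 3) * altsum (m + 3)\<close>, with total coefficient
      \<open>j + m + 1 = Suc n\<close>.\<close>
    have a: "(real m + 3) * altsum (m + 3) = (real m + 2) * altsum (m + 2) + altsum (m + 1)"
      using altsum_rec[of "m + 1"] by (simp add: numeral_3_eq_3 add.commute)
    define c :: real where "c = fact n / fact j"
    have "count_succs (Suc (Suc n)) j = c * (real j * ((real m + 3) * altsum (m + 3))
       + (real m + 1) * (altsum (m + 1) + (real m + 2) * altsum (m + 2)))"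
      unfolding rec t1 t2 t3 c_def[symmetric] using n by (simp add: algebra_simps)
    also have "\<dots> = c * ((real j + real m + 1) * ((real m + 3) * altsum (m + 3)))"
      using a by (simp add: algebra_simps)
    also have "\<dots> = fact (Suc n) / fact j * ((real m + 3) * altsum (m + 3))"
      using n by (simp add: c_def)
    finally show ?thesis using n by (simp add: numeral_3_eq_3 Suc_diff_le add.commute)
  qed
qed

text \<open>One factorial of the binomial coefficient cancels against the one left in
  \<open>A1\<close>, which gives the shape of \<open>count_succs_formula\<close>.\<close>

lemma A2_eq:
  assumes "j < n"
  shows "A2 n (n - j) = fact (n - 1) / fact j * (real (n - j) + 1) * altsum (n - j + 1)"
proof -
  define m where "m = n - j - 1"
  have n: "n = Suc (m + j)" using assms by (simp add: m_def)
  have "real ((m + j) choose m) = fact (m + j) / (fact m * fact j)"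
    by (simp add: binomial_fact)
  moreover have "fact (m + 2) / real (m + 1) = (real m + 2) * fact m"
  proof -
    have "(fact (m + 2) :: real) = real (m + 1) * ((real m + 2) * fact m)" by (simp add: algebra_simps)
    then show ?thesis by (simp del: fact_Suc of_nat_add)
  qed
  moreover have "n - 1 = m + j" "n - j = Suc m" using n by auto
  ultimately show ?thesis
    unfolding A2_def A1_def by (simp add: altsum_def atMost_atLeast0 del: fact_Suc sum.atLeast0_atMost_Suc sum.atMost_Suc)
qed

lemma count_succs_eq_A2:
  assumes "j < n" shows "count_succs n j = A2 n (n - j)"
proof -
  obtain m where n: "n = Suc m" using assms by (cases n) auto
  then show ?thesis using A2_eq[OF assms] count_succs_formula[of j m] assms
    by (simp add: Suc_diff_le)
qed

text \<open>For the identity the insertion formula collapses to \<open>1 + n * s\<close>, so the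
  mean follows by induction without the law.\<close>

lemma sum_succs:
  assumes "n \<ge> 1"
  shows "(\<Sum>xs\<in>permutations_of_set {1..n}. real (succs xs)) = fact (n - 1) * (real n - 1)"
  using assms
proof (induction n rule: nat_induct_at_least)
  case base
  have "permutations_of_set {1::nat} = {[1]}" by auto
  then show ?case by simp
next
  case (Suc n)
  have *: "real (Suc s) + real s * real (s - 1) + (real n - real s) * real s = 1 + real n * real s" for s
    by (cases s) (auto simp: algebra_simps)
  have "(\<Sum>xs\<in>permutations_of_set {1..Suc n}. real (succs xs)) =
     fact n + real n * (\<Sum>xs\<in>permutations_of_set {1..n}. real (succs xs))"
    unfolding sum_succs_Suc[OF Suc.hyps] * by (simp add: sum.distrib sum_distrib_left)
  also have "\<dots> = fact n + real n * fact (n - 1) * (real n - 1)" using Suc.IH by simp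
  also have "real n * fact (n - 1) = fact n" using Suc.hyps by (simp add: fact_reduce)
  finally show ?case by (simp add: algebra_simps)
qed


subsection \<open>The number of blocks\<close>

lemma succs_map_upt:
  "succs (map \<tau> [1..<Suc n]) = card {i \<in> {1..n}. 1 < i \<and> \<tau> i = Suc (\<tau> (i - 1))}"
proof (induction n)
  case (Suc n)
  have eq: "{i \<in> {1..Suc n}. 1 < i \<and> \<tau> i = Suc (\<tau> (i - 1))} =
     {i \<in> {1..n}. 1 < i \<and> \<tau> i = Suc (\<tau> (i - 1))} \<union>
     (if n \<ge> 1 \<and> \<tau> (Suc n) = Suc (\<tau> n) then {Suc n} else {})"
    by (auto simp: le_Suc_eq)
  have "map \<tau> [1..<Suc (Suc n)] = map \<tau> [1..<Suc n] @ [\<tau> (Suc n)]" by simp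
  moreover have "last (map \<tau> [1..<Suc n]) = \<tau> n" if "n \<ge> 1" using that by simp
  ultimately have "succs (map \<tau> [1..<Suc (Suc n)]) =
      succs (map \<tau> [1..<Suc n]) + of_bool (n \<ge> 1 \<and> \<tau> (Suc n) = Suc (\<tau> n))"
    by (simp only: succs_snoc) (cases n; simp)
  also have "\<dots> = card {i \<in> {1..Suc n}. 1 < i \<and> \<tau> i = Suc (\<tau> (i - 1))}"
    unfolding eq Suc.IH by (subst card_Un_disjoint) auto
  finally show ?case .
qed auto

text \<open>A block is determined by its starting position, and a position starts a block exactly if
  its entry does not continue the entry on its left. The excluded positions \<open>S\<close> are
  those of the successions.\<close>

lemma card_blocks:
  assumes "\<tau> permutes {1..n}"
  shows "card (blocks n \<tau>) = n - succs (map \<tau> [1..<Suc n])"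
proof -
  define S where "S = {i \<in> {1..n}. 1 < i \<and> \<tau> i = Suc (\<tau> (i - 1))}"
  define I where "I = {1..n} - S"
  define R where "R = (\<lambda>i. {r. i + r \<le> n \<and> (\<forall>j\<le>r. \<tau> (i + j) = \<tau> i + j)})"
  \<comment> \<open>\<open>f i\<close> is the run from position \<open>i\<close>, prolonged to the
    right as far as possible.\<close>
  define f where "f = (\<lambda>i. {\<tau> i..\<tau> i + Max (R i)})"
  have inj: "\<tau> i = \<tau> j \<longleftrightarrow> i = j" for i j
    using permutes_inj[OF assms] by (simp add: inj_eq)
  have finR: "finite (R i)" for i by (rule finite_subset[of _ "{..n}"]) (auto simp: R_def)
  have runE: "\<exists>i r. C = {\<tau> i..\<tau> i + r} \<and> r \<in> R i \<and> 1 \<le> i" if "C \<in> runs n \<tau>" for C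
  proof -
    from that obtain a r i where C: "C = {a..a + r}" "1 \<le> i" "i + r \<le> n" "\<forall>j\<le>r. \<tau> (i + j) = a + j"
      unfolding runs_def by blast
    then have "\<tau> i = a" using C(4)[rule_format, of 0] by simp
    then show ?thesis using C by (intro exI[of _ i] exI[of _ r]) (auto simp: R_def)
  qed
  have runI: "{\<tau> i..\<tau> i + r} \<in> runs n \<tau>" if "r \<in> R i" "1 \<le> i" for i r
    using that unfolding runs_def R_def by blast
  have maxR: "Max (R i) \<in> R i" if "i \<in> I" for i
  proof (rule Max_in[OF finR])
    have "0 \<in> R i" using that by (auto simp: R_def I_def)
    then show "R i \<noteq> {}" by blast
  qed
  have f_run: "f i \<in> runs n \<tau>" if "i \<in> I" for i
    unfolding f_def using runI[OF maxR[OF that]] that by (auto simp: I_def)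
  have "bij_betw f I (blocks n \<tau>)"
  proof (rule bij_betwI')
    fix i j assume "i \<in> I" "j \<in> I"
    show "(f i = f j) = (i = j)"
      by (auto simp: f_def inj)
  next
    fix i assume i: "i \<in> I"
    show "f i \<in> blocks n \<tau>"
      unfolding blocks_def
    proof (intro CollectI conjI ballI impI f_run[OF i])
      fix C assume C: "C \<in> runs n \<tau>" and sub: "f i \<subseteq> C"
      obtain i' r where C': "C = {\<tau> i'..\<tau> i' + r}" "r \<in> R i'" "1 \<le> i'" using runE[OF C] by blast
      have "\<tau> i \<in> C" using sub by (auto simp: f_def)
      then obtain j where j: "\<tau> i = \<tau> i' + j" "j \<le> r" using C' by (auto simp: le_iff_add)
      have tj: "\<tau> (i' + j') = \<tau> i' + j'" if "j' \<le> r" for j' using C' that by (auto simp: R_def)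
      have ij: "i = i' + j" using tj[OF j(2)] j(1) inj by metis
      \<comment> \<open>A run that contains \<open>f i\<close> and starts further left would make
        \<open>i\<close> the second position of a succession.\<close>
      have "j = 0"
      proof (rule ccontr)
        assume "j \<noteq> 0"
        then have "\<tau> (i' + (j - 1)) = \<tau> i' + (j - 1)" using j by (intro tj) auto
        moreover have "i' + (j - 1) = i - 1" using \<open>j \<noteq> 0\<close> ij by simp
        ultimately have "\<tau> i = Suc (\<tau> (i - 1))" using j \<open>j \<noteq> 0\<close> by simp
        moreover have "1 < i" using ij \<open>j \<noteq> 0\<close> C'(3) by simp
        ultimately show False using i by (auto simp: I_def S_def)
      qed
      then have "r \<le> Max (R i)" using C' ij by (intro Max_ge[OF finR]) simp
      then show "C = f i" using sub \<open>j = 0\<close> ij C' by (auto simp: f_def)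
    qed
  next
    fix B assume B: "B \<in> blocks n \<tau>"
    then have Br: "B \<in> runs n \<tau>" and Bmax: "\<And>C. C \<in> runs n \<tau> \<Longrightarrow> B \<subseteq> C \<Longrightarrow> C = B"
      by (auto simp: blocks_def)
    obtain i s where i: "B = {\<tau> i..\<tau> i + s}" "s \<in> R i" "1 \<le> i" using runE[OF Br] by blast
    \<comment> \<open>A run starting in \<open>S\<close> can be prolonged by one to the left, so it
      is not maximal.\<close>
    have "i \<notin> S"
    proof
      assume "i \<in> S"
      then have s: "1 < i" "\<tau> i = Suc (\<tau> (i - 1))" by (auto simp: S_def)
      have "\<tau> (i - 1 + j) = \<tau> (i - 1) + j" if "j \<le> Suc s" for j
        using that i(2) s by (cases j) (auto simp: R_def)
      then have "Suc s \<in> R (i - 1)" using i(2) s by (auto simp: R_def)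
      then have "{\<tau> (i - 1)..\<tau> (i - 1) + Suc s} \<in> runs n \<tau>" using s by (intro runI) auto
      then have "{\<tau> (i - 1)..\<tau> (i - 1) + Suc s} = B" by (rule Bmax) (use s i in auto)
      moreover have "\<tau> (i - 1) \<notin> B" using i s by auto
      moreover have "\<tau> (i - 1) \<in> {\<tau> (i - 1)..\<tau> (i - 1) + Suc s}" by auto
      ultimately show False by metis
    qed
    then have iI: "i \<in> I" using i by (auto simp: I_def R_def)
    have "s \<le> Max (R i)" using i by (intro Max_ge[OF finR])
    then have "f i = B" by (intro Bmax f_run[OF iI]) (auto simp: f_def i)
    then show "\<exists>i\<in>I. B = f i" using iI by blast
  qed
  then have "card (blocks n \<tau>) = card I" by (simp add: bij_betw_same_card)
  also have "card I = n - card S" unfolding I_def by (subst card_Diff_subset) (auto simp: S_def)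
  finally show ?thesis unfolding S_def succs_map_upt .
qed

text \<open>Links permutations as functions with permutations as words. Surjectivity is by counting:
  both finite sets have the same size.\<close>

lemma bij_betw_map_permutes:
  assumes "distinct xs"
  shows "bij_betw (\<lambda>\<tau>. map \<tau> xs) {\<tau>. \<tau> permutes set xs} (permutations_of_set (set xs))"
proof -
  have inj: "inj_on (\<lambda>\<tau>. map \<tau> xs) {\<tau>. \<tau> permutes set xs}"
  proof (rule inj_onI, clarify, rule ext)
    fix \<sigma> \<tau> x assume "\<sigma> permutes set xs" "\<tau> permutes set xs" "map \<sigma> xs = map \<tau> xs"
    then show "\<sigma> x = \<tau> x" by (cases "x \<in> set xs") (auto simp: permutes_not_in)
  qed
  have sub: "(\<lambda>\<tau>. map \<tau> xs) ` {\<tau>. \<tau> permutes set xs} \<subseteq> permutations_of_set (set xs)"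
  proof (rule image_subsetI)
    fix \<tau> assume "\<tau> \<in> {\<tau>. \<tau> permutes set xs}"
    then have \<tau>: "\<tau> permutes set xs" by simp
    show "map \<tau> xs \<in> permutations_of_set (set xs)"
      using assms permutes_inj_on[OF \<tau>] permutes_image[OF \<tau>] by (intro permutations_of_setI) (auto simp: distinct_map)
  qed
  have "card ((\<lambda>\<tau>. map \<tau> xs) ` {\<tau>. \<tau> permutes set xs}) = card (permutations_of_set (set xs))"
    using inj by (simp add: card_image card_permutations)
  with sub have "(\<lambda>\<tau>. map \<tau> xs) ` {\<tau>. \<tau> permutes set xs} = permutations_of_set (set xs)"
    by (intro card_subset_eq) auto
  with inj show ?thesis by (simp add: bij_betw_def)
qed

lemma sum_card_blocks:
  "(\<Sum>\<tau> | \<tau> permutes {1..n}. g (card (blocks n \<tau>))) =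
   (\<Sum>xs\<in>permutations_of_set {1..n}. g (n - succs xs))"
proof -
  have bij: "bij_betw (\<lambda>\<tau>. map \<tau> [1..<Suc n]) {\<tau>. \<tau> permutes {1..n}} (permutations_of_set {1..n})"
    using bij_betw_map_permutes[of "[1..<Suc n]"] by (simp only: set_upt distinct_upt atLeastLessThanSuc_atLeastAtMost simp_thms)
  show ?thesis
    by (subst sum.reindex_bij_betw[OF bij, symmetric]) (auto intro!: sum.cong simp: card_blocks)
qed

section \<open>Law and mean of the number of blocks of a uniform permutation\<close>

definition block_pmf :: "nat \<Rightarrow> nat pmf" where
  "block_pmf n = map_pmf (\<lambda>\<tau>. card (blocks n \<tau>)) (pmf_of_set {\<tau>. \<tau> permutes {1..n}})"

lemma permutes_nonempty: "{\<tau>. \<tau> permutes A} \<noteq> {}"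
  using permutes_id by blast

lemma pmf_block_pmf:
  assumes "1 \<le> k" "k \<le> n"
  shows "pmf (block_pmf n) k = A2 n k / fact n"
proof -
  let ?P = "{\<tau>. \<tau> permutes {1..n}}"
  have fin: "finite ?P" by (simp add: finite_permutations)
  have "pmf (block_pmf n) k = real (card (?P \<inter> {\<tau>. card (blocks n \<tau>) = k})) / fact n"
    unfolding block_pmf_def pmf_map measure_pmf_of_set[OF permutes_nonempty fin]
    by (simp add: card_permutations vimage_def)
  also have "real (card (?P \<inter> {\<tau>. card (blocks n \<tau>) = k})) = (\<Sum>\<tau>\<in>?P. of_bool (card (blocks n \<tau>) = k))"
    using fin by simp
  also have "\<dots> = (\<Sum>xs\<in>permutations_of_set {1..n}. of_bool (n - succs xs = k))"
    by (rule sum_card_blocks)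
  also have "\<dots> = count_succs n (n - k)"
    unfolding count_succs_def
  proof (intro sum.cong refl)
    fix xs assume "xs \<in> permutations_of_set {1..n}"
    then have "length xs = n" by (auto simp: permutations_of_set_def dest: distinct_card)
    then have "succs xs \<le> n" using succs_le_length by metis
    then show "of_bool (n - succs xs = k) = of_bool (succs xs = n - k)" using assms by (auto simp: of_bool_def)
  qed
  also have "\<dots> = A2 n k" using count_succs_eq_A2[of "n - k" n] assms by simp
  finally show ?thesis .
qed

lemma set_block_pmf:
  assumes "n \<ge> 1"
  shows "set_pmf (block_pmf n) \<subseteq> {1..n}"
proof -
  have "card (blocks n \<tau>) \<in> {1..n}" if "\<tau> permutes {1..n}" for \<tau>
    using succs_less_length[of "map \<tau> [1..<Suc n]"] assms card_blocks[OF that] by auto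
  then show ?thesis unfolding block_pmf_def
    by (simp only: set_map_pmf set_pmf_of_set[OF permutes_nonempty finite_permutations[OF finite_atLeastAtMost]]) auto
qed

lemma sum_block_pmf:
  assumes "n \<ge> 1"
  shows "(\<Sum>k=1..n. pmf (block_pmf n) k) = 1"
  using set_block_pmf[OF assms] by (intro sum_pmf_eq_1) auto

text \<open>By \<open>sum_succs\<close> the mean number of successions is
  \<open>(n - 1) / n\<close>. The exact term \<open>1 / n\<close> becomes the right-hand side of the
  equation for \<nu>.\<close>

lemma mean_block_pmf:
  assumes "n \<ge> 1"
  shows "(\<Sum>k=1..n. pmf (block_pmf n) k * real k) = real n - 1 + 1 / real n"
proof -
  have "(\<Sum>k=1..n. pmf (block_pmf n) k * real k) = measure_pmf.expectation (block_pmf n) real"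
    using set_block_pmf[OF assms] by (subst integral_measure_pmf_real[where A = "{1..n}"]) (auto simp: mult.commute)
  also have "\<dots> = (\<Sum>\<tau> | \<tau> permutes {1..n}. real (card (blocks n \<tau>))) / fact n"
    unfolding block_pmf_def integral_map_pmf
    by (subst integral_pmf_of_set[OF permutes_nonempty]) (auto simp: finite_permutations card_permutations)
  also have "(\<Sum>\<tau> | \<tau> permutes {1..n}. real (card (blocks n \<tau>))) =
     (\<Sum>xs\<in>permutations_of_set {1..n}. real (n - succs xs))"
    by (rule sum_card_blocks)
  also have "\<dots> = (\<Sum>xs\<in>permutations_of_set {1..n}. real n - real (succs xs))"
  proof (intro sum.cong refl)
    fix xs assume "xs \<in> permutations_of_set {1..n}"
    then have "length xs = n" by (auto simp: permutations_of_set_def dest: distinct_card)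
    then have "succs xs \<le> n" using succs_le_length by metis
    then show "real (n - succs xs) = real n - real (succs xs)" by simp
  qed
  also have "\<dots> = fact n * real n - fact (n - 1) * (real n - 1)"
    using sum_succs[OF assms] by (simp add: sum_subtractf)
  also have "\<dots> / fact n = real n - 1 + 1 / real n"
  proof -
    have "(fact n :: real) = real n * fact (n - 1)" using assms by (simp add: fact_reduce)
    then show ?thesis using assms by (simp add: field_simps)
  qed
  finally show ?thesis .
qed

subsection \<open>The recurrence for the mean\<close>

lemma X_1: "X 1 \<omega> = 0"
proof -
  have "size_after 1 \<omega> 0 = 1" by simp
  then have "enat 0 \<in> {enat t | t. size_after 1 \<omega> t = 1}" by blast
  then have "X 1 \<omega> \<le> enat 0" unfolding X_def by (rule Inf_lower)
  then show ?thesis by (simp add: zero_enat_def[symmetric])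
qed

lemma size_after_Stream:
  "size_after n (x ## \<omega>) (Suc t) = size_after (card (blocks n (x n))) \<omega> t"
  by (induction t) (auto simp: Let_def)

text \<open>The first permutation costs one step, and the rest of the stream drives the process from
  the new size. The assumption \<open>n \<noteq> 1\<close> excludes the hitting time 0.\<close>

lemma X_Stream:
  assumes "n \<noteq> 1"
  shows "X n (x ## \<omega>) = eSuc (X (card (blocks n (x n))) \<omega>)"
proof -
  let ?k = "card (blocks n (x n))"
  have "{enat t | t. size_after n (x ## \<omega>) t = 1} = eSuc ` {enat t | t. size_after ?k \<omega> t = 1}"
  proof (intro equalityI subsetI)
    fix y assume "y \<in> {enat t | t. size_after n (x ## \<omega>) t = 1}"
    then obtain t where t: "y = enat t" "size_after n (x ## \<omega>) t = 1" by blast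
    then obtain s where "t = Suc s" using assms by (cases t) auto
    then show "y \<in> eSuc ` {enat t | t. size_after ?k \<omega> t = 1}"
      using t by (auto simp: size_after_Stream eSuc_enat intro!: image_eqI[of _ _ "enat s"] simp del: size_after.simps)
  next
    fix y assume "y \<in> eSuc ` {enat t | t. size_after ?k \<omega> t = 1}"
    then obtain s where "y = eSuc (enat s)" "size_after ?k \<omega> s = 1" by blast
    then show "y \<in> {enat t | t. size_after n (x ## \<omega>) t = 1}"
      by (auto simp: eSuc_enat size_after_Stream intro!: exI[of _ "Suc s"] simp del: size_after.simps)
  qed
  \<comment> \<open>A nonempty set of extended naturals attains its infimum; for the empty set both
    sides are infinite, which covers streams that never reach size 1.\<close>
  moreover have "Inf (eSuc ` A) = eSuc (Inf A)" for A
  proof (cases "A = {}")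
    case False
    then have "Inf A \<in> A" by (meson equals0I wellorder_InfI)
    then have "Inf (eSuc ` A) \<le> eSuc (Inf A)" by (intro Inf_lower) auto
    moreover have "eSuc (Inf A) \<le> Inf (eSuc ` A)" by (intro Inf_greatest) (auto intro: Inf_lower)
    ultimately show ?thesis by (rule antisym)
  qed (simp add: Inf_enat_def)
  ultimately show ?thesis unfolding X_def by simp
qed

section \<open>Measurability and conditioning on the first permutation\<close>

abbreviation perms_space :: "(nat \<Rightarrow> nat \<Rightarrow> nat) measure" where
  "perms_space \<equiv> PiM UNIV (\<lambda>k. measure_pmf (pmf_of_set {\<tau>. \<tau> permutes {1..k}}))"

interpretation perms: prob_space perms_space
  by (intro prob_space_PiM measure_pmf.prob_space_axioms)

lemma measurable_size_after [measurable]: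
  "(\<lambda>\<omega>. size_after n \<omega> t) \<in> measurable perm_space (count_space UNIV)"
proof (induction t)
  case (Suc t)
  have [measurable]: "(\<lambda>\<omega>. (\<omega> !! t) k) \<in> measurable perm_space (count_space UNIV)" for k
  proof -
    have "(\<lambda>x. x k) \<in> measurable perms_space (count_space UNIV)"
      using measurable_component_singleton[of k UNIV "\<lambda>k. measure_pmf (pmf_of_set {\<tau>. \<tau> permutes {1..k}})"]
      by (simp cong: measurable_cong_sets)
    then show ?thesis unfolding perm_space_def
      by (rule measurable_compose[OF measurable_snth])
  qed
  have card: "(\<lambda>\<omega>. card (blocks k ((\<omega> !! t) k))) \<in> measurable perm_space (count_space UNIV)" for k
    by (rule measurable_compose[of "\<lambda>\<omega>. (\<omega> !! t) k" _ "count_space UNIV"]) simp_all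
  \<comment> \<open>The index \<open>k\<close> is itself random, but it ranges over a countable set,
    so measurability for each fixed \<open>k\<close> suffices.\<close>
  have "(\<lambda>\<omega>. (\<lambda>k \<omega>. card (blocks k ((\<omega> !! t) k))) (size_after n \<omega> t) \<omega>)
      \<in> measurable perm_space (count_space UNIV)"
    by (rule measurable_compose_countable[OF card Suc])
  then show ?case by (simp add: Let_def)
qed simp

lemma measurable_X [measurable]: "X n \<in> measurable perm_space (count_space UNIV)"
proof -
  \<comment> \<open>A countable infimum over a fixed index set replaces the infimum over a random
    set.\<close>
  have "X n = (\<lambda>\<omega>. INF t. if size_after n \<omega> t = 1 then enat t else \<infinity>)"
  proof
    fix \<omega>
    show "X n \<omega> = (INF t. if size_after n \<omega> t = 1 then enat t else \<infinity>)"
      unfolding X_def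
    proof (rule antisym)
      show "Inf {enat t | t. size_after n \<omega> t = 1} \<le> (INF t. if size_after n \<omega> t = 1 then enat t else \<infinity>)"
        by (rule INF_greatest) (auto intro: Inf_lower)
      show "(INF t. if size_after n \<omega> t = 1 then enat t else \<infinity>) \<le> Inf {enat t | t. size_after n \<omega> t = 1}"
      proof (rule Inf_greatest, clarify)
        fix t assume "size_after n \<omega> t = 1"
        then show "(INF t. if size_after n \<omega> t = 1 then enat t else \<infinity>) \<le> enat t"
          using INF_lower[of t UNIV "\<lambda>t. if size_after n \<omega> t = 1 then enat t else \<infinity>"] by simp
      qed
    qed
  qed
  moreover have "(\<lambda>\<omega>. INF t. if size_after n \<omega> t = 1 then enat t else \<infinity>)
      \<in> measurable perm_space (count_space UNIV)"
    by (intro measurable_INF measurable_compose[OF measurable_size_after]) auto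
  ultimately show ?thesis by (simp only:)
qed

lemma measurable_fun_X [measurable]:
  fixes f :: "enat \<Rightarrow> ennreal"
  shows "(\<lambda>\<omega>. f (X n \<omega>)) \<in> borel_measurable perm_space"
  by (rule measurable_compose[OF measurable_X]) simp

text \<open>The stream measure splits off its head, of which only coordinate \<open>n\<close>
  matters; its marginal is uniform and is pushed forward to \<open>block_pmf n\<close>. A general
  \<open>f\<close> covers both the truncated and the full count of steps.\<close>

lemma nn_integral_X_step:
  fixes f :: "enat \<Rightarrow> ennreal"
  assumes "n \<noteq> 1"
  shows "(\<integral>\<^sup>+ \<omega>. f (X n \<omega>) \<partial>perm_space) =
    (\<integral>\<^sup>+ k. (\<integral>\<^sup>+ \<omega>. f (eSuc (X k \<omega>)) \<partial>perm_space) \<partial>block_pmf n)"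
proof -
  define M where "M = (\<lambda>k. measure_pmf (pmf_of_set {\<tau>. \<tau> permutes {1..k::nat}}))"
  define h where "h = (\<lambda>k. \<integral>\<^sup>+ \<omega>. f (eSuc (X k \<omega>)) \<partial>perm_space)"
  have "(\<integral>\<^sup>+ \<omega>. f (X n \<omega>) \<partial>perm_space) =
      (\<integral>\<^sup>+ x. (\<integral>\<^sup>+ \<omega>. f (X n (x ## \<omega>)) \<partial>perm_space) \<partial>perms_space)"
    unfolding perm_space_def
    by (rule perms.nn_integral_stream_space) (use measurable_fun_X in \<open>simp add: perm_space_def\<close>)
  also have "\<dots> = (\<integral>\<^sup>+ x. h (card (blocks n (x n))) \<partial>PiM UNIV M)"
    unfolding h_def M_def using assms by (simp add: X_Stream)
  also have "\<dots> = (\<integral>\<^sup>+ \<tau>. h (card (blocks n \<tau>)) \<partial>distr (PiM UNIV M) (M n) (\<lambda>x. x n))"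
    by (subst nn_integral_distr) (auto simp: M_def)
  also have "distr (PiM UNIV M) (M n) (\<lambda>x. x n) = M n"
    by (rule distr_PiM_component) (auto simp: M_def measure_pmf.prob_space_axioms)
  also have "(\<integral>\<^sup>+ \<tau>. h (card (blocks n \<tau>)) \<partial>M n) = (\<integral>\<^sup>+ k. h k \<partial>block_pmf n)"
    by (simp add: block_pmf_def M_def)
  finally show ?thesis unfolding h_def .
qed

lemma nn_integral_block_pmf:
  fixes f :: "nat \<Rightarrow> ennreal"
  assumes "n \<ge> 1"
  shows "(\<integral>\<^sup>+ k. f k \<partial>block_pmf n) = (\<Sum>k=1..n. f k * ennreal (pmf (block_pmf n) k))"
  using set_block_pmf[OF assms] by (intro nn_integral_measure_pmf_support) auto

interpretation perm: prob_space perm_space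
  unfolding perm_space_def by (rule perms.prob_space_stream_space)

text \<open>
  The step equation alone does not exclude an infinite mean, so finiteness comes from truncations.
  The bound \<open>2 (n - 1)\<close> works because a step removes \<open>1 - 1 / n \<ge> 1 / 2\<close> elements on average.
\<close>

lemma nn_integral_X_truncated_le:
  assumes "n \<ge> 1"
  shows "(\<integral>\<^sup>+ \<omega>. min (ennreal_of_enat (X n \<omega>)) (of_nat T) \<partial>perm_space) \<le> ennreal (2 * (real n - 1))"
  using assms
proof (induction T arbitrary: n)
  case 0
  then show ?case by simp
next
  case (Suc T)
  show ?case
  proof (cases "n = 1")
    case True
    then show ?thesis by (simp only: X_1) simp
  next
    case False
    have min: "min (ennreal_of_enat (eSuc x)) (of_nat (Suc T)) = 1 + min (ennreal_of_enat x) (of_nat T)" for x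
      by (simp add: min_def)
    have "(\<integral>\<^sup>+ \<omega>. min (ennreal_of_enat (X n \<omega>)) (of_nat (Suc T)) \<partial>perm_space) =
        (\<integral>\<^sup>+ k. (\<integral>\<^sup>+ \<omega>. min (ennreal_of_enat (eSuc (X k \<omega>))) (of_nat (Suc T)) \<partial>perm_space) \<partial>block_pmf n)"
      by (rule nn_integral_X_step[OF False])
    also have "\<dots> = (\<integral>\<^sup>+ k. 1 + (\<integral>\<^sup>+ \<omega>. min (ennreal_of_enat (X k \<omega>)) (of_nat T) \<partial>perm_space) \<partial>block_pmf n)"
      unfolding min by (subst nn_integral_add) (auto simp: perm.emeasure_space_1)
    also have "\<dots> = (\<Sum>k=1..n. (1 + (\<integral>\<^sup>+ \<omega>. min (ennreal_of_enat (X k \<omega>)) (of_nat T) \<partial>perm_space))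
        * ennreal (pmf (block_pmf n) k))"
      by (rule nn_integral_block_pmf[OF Suc.prems])
    also have "\<dots> \<le> (\<Sum>k=1..n. (1 + ennreal (2 * (real k - 1))) * ennreal (pmf (block_pmf n) k))"
      by (intro sum_mono mult_right_mono add_left_mono Suc.IH) auto
    also have "\<dots> = (\<Sum>k=1..n. ennreal (pmf (block_pmf n) k * (2 * real k - 1)))"
    proof (intro sum.cong refl)
      fix k assume k: "k \<in> {1..n}"
      have "1 + ennreal (2 * (real k - 1)) = ennreal (1 + 2 * (real k - 1))"
        using k by (subst ennreal_plus) auto
      then show "(1 + ennreal (2 * (real k - 1))) * ennreal (pmf (block_pmf n) k) =
          ennreal (pmf (block_pmf n) k * (2 * real k - 1))"
        using k by (simp add: ennreal_mult' algebra_simps flip: ennreal_mult)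
    qed
    also have "\<dots> = ennreal (\<Sum>k=1..n. pmf (block_pmf n) k * (2 * real k - 1))"
      by (intro sum_ennreal) auto
    also have "(\<Sum>k=1..n. pmf (block_pmf n) k * (2 * real k - 1)) =
       2 * (\<Sum>k=1..n. pmf (block_pmf n) k * real k) - (\<Sum>k=1..n. pmf (block_pmf n) k)"
      by (simp add: algebra_simps sum_subtractf sum_distrib_left)
    also have "\<dots> = 2 * (real n - 1 + 1 / real n) - 1"
      using Suc.prems by (simp only: mean_block_pmf sum_block_pmf)
    \<comment> \<open>This amounts to \<open>2 / n \<le> 1\<close>, true since
      \<open>n \<ge> 2\<close> here.\<close>
    also have "ennreal \<dots> \<le> ennreal (2 * (real n - 1))"
      using False Suc.prems by (intro ennreal_leI) (auto simp: field_simps)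
    finally show ?thesis .
  qed
qed

text \<open>The bound on the truncations is uniform in \<open>T\<close>, so monotone convergence
  removes the truncation.\<close>

lemma nn_integral_X_le:
  assumes "n \<ge> 1"
  shows "(\<integral>\<^sup>+ \<omega>. ennreal_of_enat (X n \<omega>) \<partial>perm_space) \<le> ennreal (2 * (real n - 1))"
proof -
  have sup: "ennreal_of_enat x = (SUP T. min (ennreal_of_enat x) (of_nat T))" for x
  proof -
    have "(SUP T. min (ennreal_of_enat x) (of_nat T)) = inf (ennreal_of_enat x) (SUP T. of_nat T)"
      by (simp add: inf_SUP flip: inf_min)
    then show ?thesis by (simp add: ennreal_SUP_of_nat_eq_top)
  qed
  have "(\<integral>\<^sup>+ \<omega>. ennreal_of_enat (X n \<omega>) \<partial>perm_space) =
     (\<integral>\<^sup>+ \<omega>. (SUP T. min (ennreal_of_enat (X n \<omega>)) (of_nat T)) \<partial>perm_space)"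
    by (subst sup) simp
  also have "\<dots> = (SUP T. \<integral>\<^sup>+ \<omega>. min (ennreal_of_enat (X n \<omega>)) (of_nat T) \<partial>perm_space)"
    by (intro nn_integral_monotone_convergence_SUP incseq_SucI)
      (auto simp: le_fun_def min_le_iff_disj intro: order_trans)
  also have "\<dots> \<le> ennreal (2 * (real n - 1))"
    by (intro SUP_least nn_integral_X_truncated_le assms)
  finally show ?thesis .
qed

text \<open>\<open>enn2real\<close> sends infinity to 0; only finiteness makes \<mu> the true
  expectation.\<close>

lemma nn_integral_X:
  assumes "n \<ge> 1"
  shows "(\<integral>\<^sup>+ \<omega>. ennreal_of_enat (X n \<omega>) \<partial>perm_space) = ennreal (\<mu> n)"
  unfolding \<mu>_def using nn_integral_X_le[OF assms]
  by (metis ennreal_enn2real ennreal_less_top le_less_trans)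

lemma \<mu>_nonneg: "\<mu> n \<ge> 0"
  by (simp add: \<mu>_def)

text \<open>First-step analysis. The summand \<open>k = n\<close> puts \<open>\<mu> n\<close> on
  both sides, which is meaningful because all values are finite.\<close>

lemma \<mu>_rec:
  assumes "n \<ge> 2"
  shows "\<mu> n = 1 + (\<Sum>k=1..n. pmf (block_pmf n) k * \<mu> k)"
proof -
  have "ennreal (\<mu> n) = (\<integral>\<^sup>+ k. (\<integral>\<^sup>+ \<omega>. ennreal_of_enat (eSuc (X k \<omega>)) \<partial>perm_space) \<partial>block_pmf n)"
    using assms by (subst nn_integral_X[symmetric], simp, intro nn_integral_X_step) auto
  also have "\<dots> = (\<integral>\<^sup>+ k. 1 + (\<integral>\<^sup>+ \<omega>. ennreal_of_enat (X k \<omega>) \<partial>perm_space) \<partial>block_pmf n)"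
    by (simp add: nn_integral_add perm.emeasure_space_1)
  also have "\<dots> = (\<Sum>k=1..n. (1 + (\<integral>\<^sup>+ \<omega>. ennreal_of_enat (X k \<omega>) \<partial>perm_space)) * ennreal (pmf (block_pmf n) k))"
    using assms by (intro nn_integral_block_pmf) auto
  also have "\<dots> = (\<Sum>k=1..n. ennreal (pmf (block_pmf n) k * (1 + \<mu> k)))"
    using \<mu>_nonneg by (intro sum.cong refl) (auto simp: nn_integral_X ennreal_mult mult.commute simp flip: ennreal_plus ennreal_1)
  also have "\<dots> = ennreal (\<Sum>k=1..n. pmf (block_pmf n) k * (1 + \<mu> k))"
    using \<mu>_nonneg by (intro sum_ennreal) auto
  finally have "\<mu> n = (\<Sum>k=1..n. pmf (block_pmf n) k * (1 + \<mu> k))"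
    using \<mu>_nonneg by (subst (asm) ennreal_inj) (auto intro!: sum_nonneg)
  then show ?thesis using sum_block_pmf[of n] assms by (simp add: algebra_simps sum.distrib)
qed

subsection \<open>Dobinski's formula and the Poisson approximation\<close>

lemma Bell_0: "Bell 0 = 1"
  by (simp add: Bell_def)

text \<open>Comparison of coefficients in \<open>F' = F * exp x\<close>, the differential equation
  of \<open>F = exp (exp x - 1)\<close>.\<close>

lemma Bell_Suc: "Bell (Suc l) = (\<Sum>i\<le>l. real (l choose i) * Bell i)"
proof -
  define F :: "real fps" where "F = fps_exp 1 oo (fps_exp 1 - 1)"
  have "fps_deriv F = F * fps_exp 1"
    unfolding F_def by (subst fps_compose_deriv) simp_all
  then have "fps_nth (fps_deriv F) l = fps_nth (F * fps_exp 1) l" by simp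
  then have "real (Suc l) * fps_nth F (Suc l) = (\<Sum>i\<le>l. fps_nth F i / fact (l - i))"
    by (simp add: fps_mult_nth atMost_atLeast0)
  moreover have "Bell (Suc l) = fact l * (real (Suc l) * fps_nth F (Suc l))"
    unfolding Bell_def F_def[symmetric] by (simp add: algebra_simps)
  ultimately have "Bell (Suc l) = fact l * (\<Sum>i\<le>l. fps_nth F i / fact (l - i))"
    by (simp only:)
  also have "\<dots> = (\<Sum>i\<le>l. real (l choose i) * Bell i)"
    unfolding sum_distrib_left Bell_def F_def[symmetric]
    by (intro sum.cong refl) (simp add: binomial_fact)
  finally show ?thesis .
qed

lemma binomial_div_fact:
  "real (Suc j) ^ l / fact j = (\<Sum>i\<le>l. real (l choose i) * (real j ^ i / fact j))"
proof -
  have "real (Suc j) ^ l = (\<Sum>i\<le>l. real (l choose i) * real j ^ i)"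
    using binomial_ring[of "real j" 1 l] by (simp add: add.commute)
  then show ?thesis by (simp add: sum_divide_distrib)
qed

text \<open>Dobinski's formula. Shifting \<open>j\<close> cancels one factor \<open>Suc j\<close>
  against the factorial; the binomial expansion of the remaining power then reproduces the Bell
  recurrence.\<close>

lemma sums_power_div_fact: "(\<lambda>j. real j ^ l / fact j) sums (exp 1 * Bell l)"
proof (induction l rule: less_induct)
  case (less l)
  show ?case
  proof (cases l)
    case 0
    then show ?thesis using exp_converges[of "1::real"] by (simp add: Bell_0 divide_inverse)
  next
    case (Suc m)
    have "(\<lambda>j. \<Sum>i\<le>m. real (m choose i) * (real j ^ i / fact j)) sums
        (\<Sum>i\<le>m. real (m choose i) * (exp 1 * Bell i))"
      using Suc by (intro sums_sum sums_mult less.IH) auto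
    then have "(\<lambda>j. real (Suc j) ^ Suc m / fact (Suc j)) sums (exp 1 * Bell (Suc m))"
      unfolding binomial_div_fact[symmetric] Bell_Suc
      by (simp add: sum_distrib_left mult_ac divide_simps)
    \<comment> \<open>The exponent is positive, so the term \<open>j = 0\<close> lost in the shift
      is zero.\<close>
    then show ?thesis using Suc by (subst (asm) sums_Suc_iff) simp
  qed
qed

lemmas summable_power_div_fact = sums_summable[OF sums_power_div_fact]

lemma summable_Suc_power_div_fact: "summable (\<lambda>j. real (Suc j) ^ l / fact j)"
  unfolding binomial_div_fact by (intro summable_sum summable_mult summable_power_div_fact)

text \<open>A finite constant depending only on \<open>l\<close>, in terms of which errors uniform
  in \<open>n\<close> are expressed. The base \<open>Suc j\<close> is at least 1, so a higher power
  dominates all lower ones.\<close>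

definition pow_sum :: "nat \<Rightarrow> real" where
  "pow_sum l = (\<Sum>j. real (Suc j) ^ l / fact j)"

lemma sum_le_pow_sum: "(\<Sum>j<n. real (Suc j) ^ l / fact j) \<le> pow_sum l"
  unfolding pow_sum_def by (intro sum_le_suminf summable_Suc_power_div_fact) auto

lemma pow_sum_nonneg: "pow_sum l \<ge> 0"
  unfolding pow_sum_def by (intro suminf_nonneg summable_Suc_power_div_fact) auto

text \<open>In the tail \<open>j \<ge> n\<close>, one additional power of \<open>Suc j\<close> buys
  the factor \<open>1 / n\<close>.\<close>

lemma partial_sum_power_div_fact_approx:
  assumes "n \<ge> 1"
  shows "\<bar>(\<Sum>j<n. real j ^ l / fact j) - exp 1 * Bell l\<bar> \<le> pow_sum (Suc l) / real n"
proof -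
  let ?f = "\<lambda>j. real j ^ l / fact j"
  let ?g = "\<lambda>j. real (Suc j) ^ Suc l / fact j"
  have "exp 1 * Bell l = (\<Sum>j. ?f (j + n)) + (\<Sum>j<n. ?f j)"
    using suminf_split_initial_segment[OF summable_power_div_fact] sums_unique[OF sums_power_div_fact]
    by metis
  moreover have "0 \<le> (\<Sum>j. ?f (j + n))"
    by (intro suminf_nonneg summable_ignore_initial_segment summable_power_div_fact) auto
  moreover have "(\<Sum>j. ?f (j + n)) \<le> (\<Sum>j. ?g (j + n) / real n)"
  proof (intro suminf_le)
    fix j
    have "real (j + n) ^ l * real n \<le> real (Suc (j + n)) ^ l * real (Suc (j + n))"
      by (intro mult_mono power_mono) auto
    then show "?f (j + n) \<le> ?g (j + n) / real n" using assms
      by (simp add: divide_simps mult_ac del: of_nat_Suc of_nat_add)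
  qed (intro summable_divide summable_ignore_initial_segment summable_power_div_fact summable_Suc_power_div_fact)+
  moreover have "(\<Sum>j. ?g (j + n) / real n) = (\<Sum>j. ?g (j + n)) / real n"
    by (intro suminf_divide summable_ignore_initial_segment summable_Suc_power_div_fact)
  moreover have "(\<Sum>j. ?g (j + n)) \<le> pow_sum (Suc l)"
  proof -
    have "pow_sum (Suc l) = (\<Sum>j. ?g (j + n)) + (\<Sum>j<n. ?g j)"
      unfolding pow_sum_def by (rule suminf_split_initial_segment[OF summable_Suc_power_div_fact])
    moreover have "(\<Sum>j<n. ?g j) \<ge> 0" by (intro sum_nonneg) auto
    ultimately show ?thesis by linarith
  qed
  then have "(\<Sum>j. ?g (j + n)) / real n \<le> pow_sum (Suc l) / real n" by (intro divide_right_mono) auto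
  ultimately show ?thesis by linarith
qed

section \<open>Distance of the block law from the Poisson law\<close>

lemma altsum_approx: "\<bar>altsum m - exp (-1)\<bar> \<le> 3 / real (Suc m)"
proof -
  obtain t where t: "\<bar>t\<bar> \<le> \<bar>-1::real\<bar>"
    "exp (-1) = (\<Sum>i<Suc m. (-1) ^ i / fact i) + exp t / fact (Suc m) * (-1) ^ Suc m"
    using Maclaurin_exp_le[of "-1" "Suc m"] by blast
  have "\<bar>altsum m - exp (-1)\<bar> = exp t / fact (Suc m)"
    unfolding t(2) altsum_def lessThan_Suc_atMost by (simp add: abs_mult power_abs del: fact_Suc)
  also have "\<dots> \<le> 3 / fact (Suc m)"
    using t exp_le by (intro divide_right_mono) (auto intro: order_trans[of _ "exp 1"])
  also have "\<dots> \<le> 3 / real (Suc m)"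
  proof (rule divide_left_mono)
    show "real (Suc m) \<le> fact (Suc m)"
      using fact_ge_self[of "Suc m"] by (metis of_nat_fact of_nat_le_iff)
  qed (auto simp del: fact_Suc)
  finally show ?thesis .
qed

lemma abs_altsum_le: "\<bar>altsum m\<bar> \<le> 4"
proof -
  have "3 / real (Suc m) \<le> 3" by (simp add: divide_simps)
  moreover have "exp (-1::real) \<le> 1" "exp (-1::real) > 0" by auto
  ultimately show ?thesis using altsum_approx[of m] by linarith
qed

text \<open>Cleared of denominators, this follows from \<open>j * j \<le> n * j\<close>. It trades
  \<open>1 / (n - j + 1)\<close> for \<open>1 / n\<close> at the price of a factor
  \<open>j + 1\<close>, which the weights \<open>1 / fact j\<close> absorb.\<close>

lemma inverse_diff_le:
  assumes "j < n"
  shows "1 / (real (n - j) + 1) \<le> (real j + 1) / real n"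
proof -
  have "j * j \<le> n * j" using assms by (intro mult_right_mono) auto
  then have "real j * real j \<le> real n * real j" by (metis of_nat_le_iff of_nat_mult)
  then show ?thesis using assms by (simp add: divide_simps of_nat_diff algebra_simps)
qed

lemma block_pmf_diff:
  assumes "j < n"
  shows "pmf (block_pmf n) (n - j) = (real (n - j) + 1) / real n * altsum (n - j + 1) / fact j"
proof -
  have "(fact n :: real) = real n * fact (n - 1)" using assms by (simp add: fact_reduce)
  then show ?thesis
    using assms by (simp add: pmf_block_pmf A2_eq)
qed

text \<open>The constant is \<open>7 = 3 + 4\<close>: 3 for replacing \<open>altsum\<close> by
  \<open>exp (-1)\<close>, and 4, the bound on \<open>altsum\<close>, for replacing the prefactor by
  1.\<close>

lemma block_pmf_approx:
  assumes "j < n"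
  shows "\<bar>pmf (block_pmf n) (n - j) - exp (-1) / fact j\<bar> \<le> 7 / real n * (real (Suc j) / fact j)"
proof -
  define S where "S = altsum (n - j + 1)"
  have q: "(real (n - j) + 1) / real n = 1 - (real j - 1) / real n"
    using assms by (simp add: divide_simps of_nat_diff)
  have "\<bar>S - exp (-1)\<bar> \<le> 3 * (1 / (real (n - j) + 1))"
  proof -
    have "\<bar>S - exp (-1)\<bar> \<le> 3 / real (Suc (n - j + 1))" unfolding S_def by (rule altsum_approx)
    also have "\<dots> \<le> 3 / (real (n - j) + 1)" by (intro divide_left_mono) auto
    finally show ?thesis by simp
  qed
  also have "\<dots> \<le> 3 * ((real j + 1) / real n)"
    by (intro mult_left_mono inverse_diff_le assms) auto
  finally have 1: "\<bar>S - exp (-1)\<bar> \<le> 3 * ((real j + 1) / real n)" .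
  have 2: "\<bar>(real j - 1) / real n * S\<bar> \<le> (real j + 1) / real n * 4"
    unfolding abs_mult S_def using assms
    by (intro mult_mono abs_altsum_le) (auto simp: divide_right_mono)
  have "\<bar>(real (n - j) + 1) / real n * S - exp (-1)\<bar> \<le> 7 * ((real j + 1) / real n)"
  proof -
    have "(1 - (real j - 1) / real n) * S - exp (-1) = (S - exp (-1)) - (real j - 1) / real n * S"
      by (simp add: algebra_simps)
    then have "\<bar>(real (n - j) + 1) / real n * S - exp (-1)\<bar> \<le>
        \<bar>S - exp (-1)\<bar> + \<bar>(real j - 1) / real n * S\<bar>"
      unfolding q by linarith
    also have "\<dots> \<le> 3 * ((real j + 1) / real n) + (real j + 1) / real n * 4"
      by (intro add_mono 1 2)
    finally show ?thesis by linarith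
  qed
  then have "\<bar>(real (n - j) + 1) / real n * S - exp (-1)\<bar> / fact j \<le> 7 * ((real j + 1) / real n) / fact j"
    by (intro divide_right_mono) auto
  moreover have "pmf (block_pmf n) (n - j) - exp (-1) / fact j = ((real (n - j) + 1) / real n * S - exp (-1)) / fact j"
    unfolding block_pmf_diff[OF assms] S_def by (simp add: diff_divide_distrib)
  ultimately show ?thesis by (simp add: add.commute)
qed

lemma block_pmf_le:
  assumes "j < n"
  shows "pmf (block_pmf n) (n - j) \<le> 8 / fact j"
proof -
  have "(real (n - j) + 1) / real n * altsum (n - j + 1) \<le> 2 * 4"
  proof (rule mult_mono')
    show "altsum (n - j + 1) \<le> 4" using abs_altsum_le[of "n - j + 1"] by linarith
    \<comment> \<open>The sign is read off from the probability, in which \<open>altsum\<close> is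
      the only factor without an evident sign.\<close>
    show "0 \<le> altsum (n - j + 1)"
    proof (rule ccontr)
      assume "\<not> 0 \<le> altsum (n - j + 1)"
      then have "pmf (block_pmf n) (n - j) < 0"
        unfolding block_pmf_diff[OF assms] using assms
        by (intro divide_neg_pos mult_pos_neg) (auto simp: add_pos_nonneg)
      then show False using pmf_nonneg[of "block_pmf n" "n - j"] by linarith
    qed
  qed (use assms in \<open>auto simp: divide_simps of_nat_diff\<close>)
  then show ?thesis unfolding block_pmf_diff[OF assms] by (intro divide_right_mono) auto
qed

lemma sum_diff_reindex:
  fixes f :: "nat \<Rightarrow> real"
  shows "(\<Sum>k=1..n. f k) = (\<Sum>j<n. f (n - j))"
  by (rule sum.reindex_bij_witness[of _ "\<lambda>j. n - j" "\<lambda>k. n - k"]) auto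

text \<open>The weights are at most \<open>8 / fact j\<close>, so polynomial growth of
  \<open>f\<close> yields a bound independent of \<open>n\<close>.\<close>

lemma sum_block_pmf_mult_le:
  assumes "\<And>j. j < n \<Longrightarrow> f j \<le> c * real (Suc j) ^ l" "c \<ge> 0"
  shows "(\<Sum>j<n. pmf (block_pmf n) (n - j) * f j) \<le> 8 * c * pow_sum l"
proof -
  have "(\<Sum>j<n. pmf (block_pmf n) (n - j) * f j) \<le> (\<Sum>j<n. pmf (block_pmf n) (n - j) * (c * real (Suc j) ^ l))"
    by (intro sum_mono mult_left_mono assms) auto
  also have "\<dots> \<le> (\<Sum>j<n. 8 / fact j * (c * real (Suc j) ^ l))"
    by (intro sum_mono mult_right_mono block_pmf_le) (use assms in auto)
  also have "\<dots> = 8 * c * (\<Sum>j<n. real (Suc j) ^ l / fact j)"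
    by (simp add: sum_distrib_left mult_ac del: of_nat_Suc)
  also have "\<dots> \<le> 8 * c * pow_sum l" by (intro mult_left_mono sum_le_pow_sum) (use assms in auto)
  finally show ?thesis .
qed

text \<open>The constant is \<open>8 = 7 + 1\<close>: 7 from \<open>block_pmf_approx\<close> and 1
  from the tail of Dobinski's series.\<close>

lemma moment_block_pmf:
  assumes "n \<ge> 1"
  shows "\<bar>(\<Sum>j<n. pmf (block_pmf n) (n - j) * real j ^ l) - Bell l\<bar> \<le> 8 * pow_sum (Suc l) / real n"
proof -
  let ?p = "\<lambda>j. pmf (block_pmf n) (n - j)"
  have "\<bar>(\<Sum>j<n. ?p j * real j ^ l) - exp (-1) * (\<Sum>j<n. real j ^ l / fact j)\<bar> =
     \<bar>\<Sum>j<n. (?p j - exp (-1) / fact j) * real j ^ l\<bar>"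
    by (simp add: sum_subtractf sum_distrib_left left_diff_distrib)
  also have "\<dots> \<le> (\<Sum>j<n. \<bar>?p j - exp (-1) / fact j\<bar> * real j ^ l)"
    by (rule order_trans[OF sum_abs]) (simp add: abs_mult)
  also have "\<dots> \<le> (\<Sum>j<n. 7 / real n * (real (Suc j) / fact j) * real (Suc j) ^ l)"
    by (intro sum_mono mult_mono block_pmf_approx power_mono) auto
  also have "\<dots> = 7 / real n * (\<Sum>j<n. real (Suc j) ^ Suc l / fact j)"
    by (simp add: sum_distrib_left mult_ac del: of_nat_Suc)
  also have "\<dots> \<le> 7 / real n * pow_sum (Suc l)"
    by (intro mult_left_mono sum_le_pow_sum) auto
  finally have 1: "\<bar>(\<Sum>j<n. ?p j * real j ^ l) - exp (-1) * (\<Sum>j<n. real j ^ l / fact j)\<bar> \<le> 7 / real n * pow_sum (Suc l)" .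
  have "exp (-1) * (\<Sum>j<n. real j ^ l / fact j) - Bell l = exp (-1) * ((\<Sum>j<n. real j ^ l / fact j) - exp 1 * Bell l)"
    by (simp add: right_diff_distrib exp_minus)
  then have "\<bar>exp (-1) * (\<Sum>j<n. real j ^ l / fact j) - Bell l\<bar> = exp (-1) * \<bar>(\<Sum>j<n. real j ^ l / fact j) - exp 1 * Bell l\<bar>"
    by (simp add: abs_mult)
  also have "\<dots> \<le> 1 * (pow_sum (Suc l) / real n)"
    by (intro mult_mono partial_sum_power_div_fact_approx assms) auto
  finally have 2: "\<bar>exp (-1) * (\<Sum>j<n. real j ^ l / fact j) - Bell l\<bar> \<le> pow_sum (Suc l) / real n"
    by simp
  have "\<bar>(\<Sum>j<n. ?p j * real j ^ l) - Bell l\<bar> \<le> 7 / real n * pow_sum (Suc l) + pow_sum (Suc l) / real n"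
    using 1 2 by linarith
  then show ?thesis by (simp add: field_simps)
qed

subsection \<open>Increments of the mean\<close>

definition \<nu> :: "nat \<Rightarrow> real" where
  "\<nu> n = \<mu> n - real n"

text \<open>A step costs 1 and removes \<open>1 - 1 / n\<close> elements on average; the defect is
  \<open>1 / n\<close>.\<close>

lemma sum_block_pmf_\<nu>:
  assumes "n \<ge> 2"
  shows "(\<Sum>j<n. pmf (block_pmf n) (n - j) * (\<nu> n - \<nu> (n - j))) = 1 / real n"
proof -
  let ?p = "pmf (block_pmf n)"
  have "(\<Sum>j<n. ?p (n - j) * (\<nu> n - \<nu> (n - j))) = (\<Sum>k=1..n. ?p k * (\<nu> n - \<nu> k))"
    by (rule sum_diff_reindex[symmetric])
  also have "\<dots> = \<nu> n * (\<Sum>k=1..n. ?p k) - (\<Sum>k=1..n. ?p k * \<mu> k) + (\<Sum>k=1..n. ?p k * real k)"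
    by (simp add: \<nu>_def algebra_simps sum.distrib sum_subtractf sum_distrib_left)
  also have "\<dots> = 1 / real n"
    using assms \<mu>_rec[OF assms] sum_block_pmf[of n] mean_block_pmf[of n] by (simp add: \<nu>_def)
  finally show ?thesis .
qed

text \<open>The difference telescopes into \<open>b - a\<close> increments, each at most
  \<open>C / (a + 1)\<close>.\<close>

lemma abs_\<nu>_diff_le:
  assumes "a \<le> b" "\<And>i. a < i \<Longrightarrow> i \<le> b \<Longrightarrow> \<bar>\<nu> i - \<nu> (i - 1)\<bar> \<le> C / real i" "C \<ge> 0"
  shows "\<bar>\<nu> b - \<nu> a\<bar> \<le> C * real (b - a) / (real a + 1)"
  using assms(1,2)
proof (induction b rule: dec_induct)
  case (step b)
  have "\<bar>\<nu> (Suc b) - \<nu> b\<bar> \<le> C / real (Suc b)" using step.prems[of "Suc b"] step.hyps by simp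
  also have "\<dots> \<le> C / (real a + 1)" using step.hyps assms by (intro divide_left_mono) auto
  finally have "\<bar>\<nu> (Suc b) - \<nu> b\<bar> \<le> C / (real a + 1)" .
  moreover have "\<bar>\<nu> b - \<nu> a\<bar> \<le> C * real (b - a) / (real a + 1)"
    using step.prems by (intro step.IH) auto
  moreover have "C * real (Suc b - a) / (real a + 1) = C * real (b - a) / (real a + 1) + C / (real a + 1)"
  proof -
    have "real (Suc b - a) = real (b - a) + 1" using step.hyps by (simp add: Suc_diff_le)
    then show ?thesis by (simp add: distrib_left add_divide_distrib del: of_nat_diff)
  qed
  ultimately show ?case by linarith
qed simp

text \<open>
  In the recurrence for \<open>\<nu>\<close> the weight of the newest increment tends to \<open>1 - 1/e\<close> while the
  total weight of the older ones tends to \<open>1/e\<close>; since \<open>1/e < 1/2\<close>, the bound \<open>C / n\<close>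
  propagates.
\<close>

lemma \<nu>_step_bound:
  "\<exists>C\<ge>0. \<forall>n\<ge>2. \<bar>\<nu> n - \<nu> (n - 1)\<bar> \<le> C / real n"
proof -
  define e where "e = (\<lambda>n. \<nu> n - \<nu> (n - 1))"
  define M where "M = 8 * pow_sum 3"
  have M: "M \<ge> 0" by (simp add: M_def pow_sum_nonneg)
  \<comment> \<open>Beyond \<open>N\<close> the perturbation \<open>(14 + M) / n\<close> is at most
    \<open>1/10\<close>; \<open>14 = 2 * 7\<close> accounts for twice the error of
    \<open>p 0\<close>, and \<open>M\<close> for the cubic remainder.\<close>
  obtain N :: nat where N: "real N \<ge> 10 * (14 + M)" using real_arch_simple by blast
  \<comment> \<open>The sum makes the claim immediate up to \<open>N\<close>; the summand 10 gives
    \<open>C / 10 \<ge> 1\<close>, which pays for the right-hand side \<open>1 / n\<close>.\<close>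
  define C where "C = 10 + (\<Sum>i\<le>N. real i * \<bar>e i\<bar>)"
  have C: "C \<ge> 10" unfolding C_def by (simp add: sum_nonneg)
  have "\<bar>e n\<bar> \<le> C / real n" if "n \<ge> 2" for n
    using that
  proof (induction n rule: less_induct)
    case (less n)
    define p where "p = (\<lambda>j. pmf (block_pmf n) (n - j))"
    show ?case
    proof (cases "n \<le> N")
      case True
      then have "real n * \<bar>e n\<bar> \<le> (\<Sum>i\<le>N. real i * \<bar>e i\<bar>)"
        by (intro member_le_sum) auto
      then have "real n * \<bar>e n\<bar> \<le> C" by (simp add: C_def)
      then show ?thesis using less.prems by (simp add: field_simps)
    next
      case False
      have n: "real n \<ge> 10 * (14 + M)" using False N by linarith
      have "exp (-1::real) \<le> 2/5"
      proof -
        have "exp (1::real) \<ge> 5/2" using exp_lower_Taylor_quadratic[of "1::real"] by simp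
        then show ?thesis by (simp add: exp_minus divide_simps)
      qed
      moreover have "\<bar>p 0 - exp (-1)\<bar> \<le> 7 / real n"
        using block_pmf_approx[of 0 n] less.prems by (simp add: p_def)
      moreover have "(14 + M) / real n \<le> 1/10" using n less.prems by (simp add: divide_simps)
      ultimately have p0: "1/10 \<le> 1 - 2 * p 0 - M / real n" by (simp add: add_divide_distrib)
      have p0': "p 0 \<ge> 0" by (simp add: p_def)
      have Mn: "M / real n \<ge> 0" using M by simp
      have old: "\<bar>\<nu> (n - 1) - \<nu> (n - j)\<bar> \<le> C / real n * ((real j - 1) + real (Suc j) ^ 3 / real n)"
        if j: "1 \<le> j" "j < n" for j
      proof -
        have "\<bar>\<nu> (n - 1) - \<nu> (n - j)\<bar> \<le> C * real ((n - 1) - (n - j)) / (real (n - j) + 1)"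
          using j C less.IH by (intro abs_\<nu>_diff_le) (auto simp: e_def)
        also have "\<dots> = C * (real j - 1) * (1 / (real (n - j) + 1))"
          using j by (simp add: of_nat_diff)
        \<comment> \<open>The crude estimate would spoil the leading constant. This identity
          isolates \<open>1 / n\<close> exactly, and \<open>inverse_diff_le\<close> is applied only
          to the second-order remainder.\<close>
        also have "1 / (real (n - j) + 1) = (1 + (real j - 1) * (1 / (real (n - j) + 1))) / real n"
          using j by (simp add: divide_simps of_nat_diff)
        also have "C * (real j - 1) * \<dots> \<le> C * (real j - 1) * ((1 + (real j - 1) * ((real j + 1) / real n)) / real n)"
          using j C by (intro mult_left_mono divide_right_mono add_left_mono inverse_diff_le) auto
        also have "\<dots> = C / real n * ((real j - 1) + (real j - 1) * (real j - 1) * (real j + 1) / real n)"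
          using less.prems by (simp add: field_simps)
        also have "\<dots> \<le> C / real n * ((real j - 1) + real (Suc j) ^ 3 / real n)"
          unfolding power3_eq_cube using j C
          by (intro mult_left_mono add_left_mono divide_right_mono mult_mono) auto
        finally show ?thesis .
      qed
      have split: "(\<Sum>j<n. f j) = f 0 + (\<Sum>j\<in>{1..<n}. f j)" for f :: "nat \<Rightarrow> real"
        using less.prems by (simp add: lessThan_atLeast0 sum.atLeast_Suc_lessThan)
      have mean: "(\<Sum>j<n. p j * (real j - 1)) = - (1 / real n)"
      proof -
        have "(\<Sum>j<n. p j * (real j - 1)) = (\<Sum>j<n. p j * (real n - 1 - real (n - j)))"
          by (intro sum.cong refl) (simp add: of_nat_diff algebra_simps)
        also have "\<dots> = (\<Sum>k=1..n. pmf (block_pmf n) k * (real n - 1 - real k))"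
          unfolding p_def by (rule sum_diff_reindex[symmetric])
        also have "\<dots> = (real n - 1) * (\<Sum>k=1..n. pmf (block_pmf n) k) - (\<Sum>k=1..n. pmf (block_pmf n) k * real k)"
          by (simp add: algebra_simps sum.distrib sum_subtractf sum_distrib_left)
        also have "\<dots> = - (1 / real n)"
          using less.prems sum_block_pmf[of n] mean_block_pmf[of n] by simp
        finally show ?thesis .
      qed
      have sum1: "(\<Sum>j\<in>{1..<n}. p j) = 1 - p 0"
      proof -
        have "(\<Sum>j<n. p j) = 1"
          unfolding p_def sum_diff_reindex[symmetric] by (rule sum_block_pmf) (use less.prems in simp)
        then show ?thesis using split[of p] by linarith
      qed
      have cube: "(\<Sum>j\<in>{1..<n}. p j * real (Suc j) ^ 3) \<le> M"
      proof -
        have "(\<Sum>j<n. p j * real (Suc j) ^ 3) \<le> 8 * 1 * pow_sum 3"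
          unfolding p_def by (rule sum_block_pmf_mult_le) auto
        then show ?thesis using split[of "\<lambda>j. p j * real (Suc j) ^ 3"] p0' by (simp add: M_def)
      qed
      \<comment> \<open>The term \<open>j = 0\<close> vanishes; every other one is split into the
        newest increment \<open>e n\<close> and the older increments.\<close>
      have "1 / real n = (\<Sum>j\<in>{1..<n}. p j * (\<nu> n - \<nu> (n - j)))"
        using sum_block_pmf_\<nu>[OF less.prems] split[of "\<lambda>j. p j * (\<nu> n - \<nu> (n - j))"] by (simp add: p_def)
      also have "\<dots> = (\<Sum>j\<in>{1..<n}. p j * e n + p j * (\<nu> (n - 1) - \<nu> (n - j)))"
        by (simp add: e_def algebra_simps)
      also have "\<dots> = (1 - p 0) * e n + (\<Sum>j\<in>{1..<n}. p j * (\<nu> (n - 1) - \<nu> (n - j)))"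
        by (simp only: sum.distrib sum_distrib_right[symmetric] sum1)
      finally have "(1 - p 0) * e n = 1 / real n - (\<Sum>j\<in>{1..<n}. p j * (\<nu> (n - 1) - \<nu> (n - j)))"
        by linarith
      then have "\<bar>(1 - p 0) * e n\<bar> \<le> 1 / real n + \<bar>\<Sum>j\<in>{1..<n}. p j * (\<nu> (n - 1) - \<nu> (n - j))\<bar>"
        by (smt (verit) of_nat_0_le_iff zero_le_divide_1_iff)
      also have "\<bar>\<Sum>j\<in>{1..<n}. p j * (\<nu> (n - 1) - \<nu> (n - j))\<bar> \<le>
          (\<Sum>j\<in>{1..<n}. p j * \<bar>\<nu> (n - 1) - \<nu> (n - j)\<bar>)"
        by (rule order_trans[OF sum_abs]) (simp add: abs_mult p_def)
      also have "\<dots> \<le> (\<Sum>j\<in>{1..<n}. p j * (C / real n * ((real j - 1) + real (Suc j) ^ 3 / real n)))"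
        by (intro sum_mono mult_left_mono old) (auto simp: p_def)
      also have "\<dots> = C / real n * ((\<Sum>j\<in>{1..<n}. p j * (real j - 1)) + (\<Sum>j\<in>{1..<n}. p j * real (Suc j) ^ 3) / real n)"
        by (simp add: sum_distrib_left sum_divide_distrib distrib_left sum.distrib mult_ac del: of_nat_Suc)
      also have "\<dots> \<le> C / real n * (p 0 + M / real n)"
      proof -
        \<comment> \<open>The term \<open>j = 0\<close> of the mean is \<open>- p 0\<close>, so
          dropping it leaves total weight \<open>p 0 - 1 / n\<close> on the older
          increments.\<close>
        have "(\<Sum>j\<in>{1..<n}. p j * (real j - 1)) = p 0 - 1 / real n"
          using split[of "\<lambda>j. p j * (real j - 1)"] unfolding mean by simp
        moreover have "1 / real n \<ge> 0" by simp
        moreover have "(\<Sum>j\<in>{1..<n}. p j * real (Suc j) ^ 3) / real n \<le> M / real n"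
          by (rule divide_right_mono[OF cube]) simp
        ultimately have "(\<Sum>j\<in>{1..<n}. p j * (real j - 1)) + (\<Sum>j\<in>{1..<n}. p j * real (Suc j) ^ 3) / real n
            \<le> p 0 + M / real n" by linarith
        then show ?thesis by (rule mult_left_mono) (use C in simp)
      qed
      also have "1 / real n + C / real n * (p 0 + M / real n) = (1 + C * (p 0 + M / real n)) / real n"
        by (simp add: add_divide_distrib)
      also have "\<dots> \<le> C * (1 - p 0) / real n"
      proof (rule divide_right_mono)
        have "C * (1/10) \<le> C * (1 - 2 * p 0 - M / real n)" using p0 C by (intro mult_left_mono) auto
        then show "1 + C * (p 0 + M / real n) \<le> C * (1 - p 0)" using C by (simp add: algebra_simps)
      qed simp
      finally have "\<bar>(1 - p 0) * e n\<bar> \<le> (1 - p 0) * (C / real n)" by (simp add: mult.commute)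
      moreover have "1 - p 0 > 0" using p0 p0' Mn by linarith
      ultimately show ?thesis
        by (simp only: abs_mult abs_of_pos mult_le_cancel_left_pos)
    qed
  qed
  then show ?thesis using C unfolding e_def by (intro exI[of _ C]) auto
qed

text \<open>Lipschitz bound for powers on \<open>[-B, B]\<close>. The exponent \<open>m\<close> in
  place of \<open>m - 1\<close>, allowed by \<open>B \<ge> 1\<close>, avoids a special case at
  \<open>m = 0\<close>.\<close>

lemma abs_power_diff_le:
  fixes x y B :: real
  assumes "\<bar>x\<bar> \<le> B" "\<bar>y\<bar> \<le> B" "B \<ge> 1"
  shows "\<bar>x ^ m - y ^ m\<bar> \<le> real m * \<bar>x - y\<bar> * B ^ m"
proof (induction m)
  case (Suc m)
  have "x ^ Suc m - y ^ Suc m = x * (x ^ m - y ^ m) + (x - y) * y ^ m" by (simp add: algebra_simps)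
  then have "\<bar>x ^ Suc m - y ^ Suc m\<bar> \<le> \<bar>x\<bar> * \<bar>x ^ m - y ^ m\<bar> + \<bar>x - y\<bar> * \<bar>y\<bar> ^ m"
    by (metis abs_mult abs_triangle_ineq power_abs)
  also have "\<dots> \<le> B * (real m * \<bar>x - y\<bar> * B ^ m) + \<bar>x - y\<bar> * B ^ Suc m"
  proof (intro add_mono mult_mono Suc.IH assms order_refl)
    have "\<bar>y\<bar> ^ m \<le> B ^ m" using assms by (intro power_mono) auto
    also have "\<dots> \<le> B ^ Suc m" using assms by (intro power_increasing) auto
    finally show "\<bar>y\<bar> ^ m \<le> B ^ Suc m" .
  qed (use assms in auto)
  also have "\<dots> = real (Suc m) * \<bar>x - y\<bar> * B ^ Suc m" by (simp add: algebra_simps)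
  finally show ?case .
qed simp

section \<open>Transfer of the moment estimate to the sum with increments of \<mu>\<close>

theorem theorem4p2:
  fixes l1 l2 :: nat
  shows "(\<lambda>n::nat. (\<Sum>k=1..n. A2 n k / fact n * (real n - real k) ^ l1 * (\<mu> n - \<mu> k) ^ l2)
                   - Bell (l1 + l2)) \<in> O(\<lambda>n. 1 / real n)"
proof -
  obtain C where C: "C \<ge> 0" "\<And>n. n \<ge> 2 \<Longrightarrow> \<bar>\<nu> n - \<nu> (n - 1)\<bar> \<le> C / real n"
    using \<nu>_step_bound by blast
  \<comment> \<open>The first summand is the cost of replacing
    \<open>\<mu> n - \<mu> (n - j)\<close> by \<open>j\<close>, the second the error of the moment
    of order \<open>l1 + l2\<close>.\<close>
  define K where "K = 8 * (real l2 * C * (C + 1) ^ l2) * pow_sum (l1 + l2 + 2) + 8 * pow_sum (Suc (l1 + l2))"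
  show ?thesis
  proof (rule bigoI[of _ K], rule eventually_sequentiallyI[of 1])
    fix n :: nat assume n: "n \<ge> 1"
    define p where "p = (\<lambda>j. pmf (block_pmf n) (n - j))"
    define S where "S = (\<Sum>k=1..n. A2 n k / fact n * (real n - real k) ^ l1 * (\<mu> n - \<mu> k) ^ l2)"
    have "S = (\<Sum>k=1..n. pmf (block_pmf n) k * ((real n - real k) ^ l1 * (\<mu> n - \<mu> k) ^ l2))"
      unfolding S_def by (intro sum.cong refl) (simp add: pmf_block_pmf)
    also have "\<dots> = (\<Sum>j<n. p j * ((real n - real (n - j)) ^ l1 * (\<mu> n - \<mu> (n - j)) ^ l2))"
      unfolding p_def by (rule sum_diff_reindex)
    also have "\<dots> = (\<Sum>j<n. p j * (real j ^ l1 * (\<mu> n - \<mu> (n - j)) ^ l2))"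
      by (intro sum.cong refl) (simp add: of_nat_diff)
    finally have S: "S = (\<Sum>j<n. p j * (real j ^ l1 * (\<mu> n - \<mu> (n - j)) ^ l2))" .
    \<comment> \<open>In the exponent, \<open>l1\<close> and \<open>l2\<close> come from the two
      powers, and 2 from the bound \<open>C * j * (j + 1) / n\<close> on the distance of the
      increment from \<open>j\<close>.\<close>
    have err: "real j ^ l1 * \<bar>(\<mu> n - \<mu> (n - j)) ^ l2 - real j ^ l2\<bar>
        \<le> real l2 * C * (C + 1) ^ l2 / real n * real (Suc j) ^ (l1 + l2 + 2)" if j: "j < n" for j
    proof -
      define x where "x = \<mu> n - \<mu> (n - j)"
      have "\<bar>\<nu> n - \<nu> (n - j)\<bar> \<le> C * real (n - (n - j)) / (real (n - j) + 1)"
        using j C by (intro abs_\<nu>_diff_le) auto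
      then have "\<bar>x - real j\<bar> \<le> C * real j * (1 / (real (n - j) + 1))"
        using j by (simp add: x_def \<nu>_def of_nat_diff)
      also have "\<dots> \<le> C * real j * ((real j + 1) / real n)"
        using C j by (intro mult_left_mono inverse_diff_le) auto
      finally have d: "\<bar>x - real j\<bar> \<le> C * real j * ((real j + 1) / real n)" .
      \<comment> \<open>Since \<open>j + 1 \<le> n\<close>, the same bound also controls the size of
        \<open>x\<close>, as the power estimate requires.\<close>
      have "C * real j * ((real j + 1) / real n) \<le> C * real j * 1"
        using C j by (intro mult_left_mono) auto
      then have xj: "\<bar>x\<bar> \<le> (C + 1) * real j" using d by (simp add: algebra_simps)
      have B: "(C + 1) * real j \<le> (C + 1) * real (Suc j)" using C by (intro mult_left_mono) auto
      have "1 * 1 \<le> (C + 1) * real (Suc j)" using C by (intro mult_mono) auto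
      moreover have "1 * real j \<le> (C + 1) * real j" using C by (intro mult_right_mono) auto
      ultimately have "\<bar>x ^ l2 - real j ^ l2\<bar> \<le> real l2 * \<bar>x - real j\<bar> * ((C + 1) * real (Suc j)) ^ l2"
        using xj B by (intro abs_power_diff_le) auto
      also have "\<dots> \<le> real l2 * (C * real (Suc j) * (real (Suc j) / real n)) * ((C + 1) * real (Suc j)) ^ l2"
      proof (intro mult_left_mono mult_right_mono)
        have "C * real j * ((real j + 1) / real n) \<le> C * real (Suc j) * (real (Suc j) / real n)"
          using C by (intro mult_mono mult_left_mono divide_right_mono) auto
        with d show "\<bar>x - real j\<bar> \<le> C * real (Suc j) * (real (Suc j) / real n)" by linarith
      qed (use C in auto)
      finally have "\<bar>x ^ l2 - real j ^ l2\<bar> \<le> real l2 * (C * real (Suc j) * (real (Suc j) / real n)) * ((C + 1) * real (Suc j)) ^ l2" .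
      then have "real j ^ l1 * \<bar>x ^ l2 - real j ^ l2\<bar> \<le>
          real (Suc j) ^ l1 * (real l2 * (C * real (Suc j) * (real (Suc j) / real n)) * ((C + 1) * real (Suc j)) ^ l2)"
        by (intro mult_mono power_mono) auto
      also have "\<dots> = real l2 * C * (C + 1) ^ l2 / real n * real (Suc j) ^ (l1 + l2 + 2)"
        by (simp add: power_add power_mult_distrib power2_eq_square mult_ac del: of_nat_Suc)
      finally show ?thesis unfolding x_def .
    qed
    have "\<bar>S - (\<Sum>j<n. p j * real j ^ (l1 + l2))\<bar> = \<bar>\<Sum>j<n. p j * (real j ^ l1 * ((\<mu> n - \<mu> (n - j)) ^ l2 - real j ^ l2))\<bar>"
      unfolding S by (simp add: right_diff_distrib power_add sum_subtractf)
    also have "\<dots> \<le> (\<Sum>j<n. p j * (real j ^ l1 * \<bar>(\<mu> n - \<mu> (n - j)) ^ l2 - real j ^ l2\<bar>))"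
      by (rule order_trans[OF sum_abs]) (simp add: abs_mult p_def)
    also have "\<dots> \<le> 8 * (real l2 * C * (C + 1) ^ l2 / real n) * pow_sum (l1 + l2 + 2)"
      unfolding p_def by (rule sum_block_pmf_mult_le[OF err]) (use C in auto)
    finally have 1: "\<bar>S - (\<Sum>j<n. p j * real j ^ (l1 + l2))\<bar> \<le>
      8 * (real l2 * C * (C + 1) ^ l2 / real n) * pow_sum (l1 + l2 + 2)" .
    have "\<bar>(\<Sum>j<n. p j * real j ^ (l1 + l2)) - Bell (l1 + l2)\<bar> \<le> 8 * pow_sum (Suc (l1 + l2)) / real n"
      unfolding p_def by (rule moment_block_pmf[OF n])
    with 1 have "\<bar>S - Bell (l1 + l2)\<bar> \<le> 8 * (real l2 * C * (C + 1) ^ l2 / real n) * pow_sum (l1 + l2 + 2)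
        + 8 * pow_sum (Suc (l1 + l2)) / real n"
      by linarith
    also have "\<dots> = K * (1 / real n)"
      by (simp add: K_def add_divide_distrib)
    finally show "norm (S - Bell (l1 + l2)) \<le> K * norm (1 / real n)" by simp
  qed
qed

end
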